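(* Let $X$ be a separable Hilbert space, $\Lambda\subset\mathbb{N}$ an infinite lacunary set, $m_1,\dots,m_d\in\mathbb{Z}$ fixed integers, and $f=(f_i)_{1\le i\le d}\in H^2(\mathbb{D},X^d)$ with $\sigma(f_i)\subset\Lambda+m_i$ for each $i$. Suppose the sequence $\big(\hat f_1(k+m_1),\hat f_2(k+m_2),\dots,\hat f_d(k+m_d)\big)_{k\ge0}$ is completely relatively compact in $X^d$. Then $f$ is cyclic for $S^*$ if and only if for every $N\ge0$, $$\operatorname{span}\big\{\big(\hat f_1(k+m_1),\dots,\hat f_d(k+m_d)\big): k\ge N\big\}=X^d.$$
   Context: $H^2(\mathbb{D},Y)$: $Y$-valued power series with square-summable coefficient norms; $X^d$ the Hilbert direct sum of $d$ copies of $X$; coordinates $f_i\in H^2(\mathbb{D},X)$; $\hat f_i(j)=0$ for $j<0$ by convention. $\sigma(g)=\{k:\hat g(k)\ne0\}$; $\Lambda+m=\{\lambda+m:\lambda\in\Lambda\}$. Lacunary: $n_{k+1}/n_k\ge c>1$. $S^*$ the backward shift; cyclic means the closed span of $\{S^{*n}f\}$ is the whole space; span is closed linear span. Completely relatively compact: for every orthogonal projection $P$, $(Pa_k/\|Pa_k\|)_{Pa_k\ne0}$ is relatively compact. *)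

theory Defs
  imports "HOL-Analysis.Analysis"
begin

text \<open>A complex Hilbert space is modelled as a real Hilbert space (type class
  real_inner + complete_space) together with a complex structure J (multiplication
  by the imaginary unit): J is real-linear, J (J x) = -x, and J is isometric for the
  real inner product (which is the real part of the complex inner product).\<close>

definition complex_structure :: "('a::real_inner \<Rightarrow> 'a) \<Rightarrow> bool" where
  "complex_structure J \<longleftrightarrow> linear J \<and> (\<forall>x. J (J x) = - x) \<and>
     (\<forall>x y. inner (J x) (J y) = inner x y)"

text \<open>complex scalar multiplication induced by J\<close>
definition csmul :: "('a::real_vector \<Rightarrow> 'a) \<Rightarrow> complex \<Rightarrow> 'a \<Rightarrow> 'a" where
  "csmul J c x = Re c *\<^sub>R x + Im c *\<^sub>R J x"

text \<open>complex linear span (finite complex linear combinations)\<close>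
definition cspan :: "('a::real_vector \<Rightarrow> 'a) \<Rightarrow> 'a set \<Rightarrow> 'a set" where
  "cspan J S = {y. \<exists>F c. finite F \<and> F \<subseteq> S \<and> y = (\<Sum>x\<in>F. csmul J (c x) x)}"

text \<open>the complex structure on X^d, acting coordinatewise\<close>
definition Jvec :: "('a \<Rightarrow> 'a) \<Rightarrow> 'a^'d \<Rightarrow> 'a^'d" where
  "Jvec J x = (\<chi> i. J (x $ i))"

text \<open>Elements of H^2(D, X^d) are given by their Taylor coefficients F :: nat => X^d\<close>
definition H2 :: "(nat \<Rightarrow> 'b::real_normed_vector) \<Rightarrow> bool" where
  "H2 F \<longleftrightarrow> summable (\<lambda>k. (norm (F k))\<^sup>2)"

definition H2_norm :: "(nat \<Rightarrow> 'b::real_normed_vector) \<Rightarrow> real" where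
  "H2_norm F = sqrt (\<Sum>k. (norm (F k))\<^sup>2)"

text \<open>S^* backward shift, iterated n times, on coefficient sequences\<close>
definition bshift :: "nat \<Rightarrow> (nat \<Rightarrow> 'b) \<Rightarrow> nat \<Rightarrow> 'b" where
  "bshift n F = (\<lambda>k. F (k + n))"

text \<open>F cyclic for S^*: the closed complex linear span (in H^2) of the S^{*n} F is all of H^2, i.e. every G in H^2 is an H^2-limit of finite complex linear combinations of the S^{*j} F\<close>
definition cyclic_bshift :: "('b::real_normed_vector \<Rightarrow> 'b) \<Rightarrow> (nat \<Rightarrow> 'b) \<Rightarrow> bool" where
  "cyclic_bshift J F \<longleftrightarrow>
     (\<forall>G. H2 G \<longrightarrow> (\<forall>e>0. \<exists>(n::nat) (c::nat \<Rightarrow> complex).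
         H2_norm (\<lambda>k. G k - (\<Sum>j<n. csmul J (c j) (bshift j F k))) < e))"

text \<open>Fourier coefficient of the i-th coordinate at an integer index (zero at negative indices)\<close>
definition coef :: "(nat \<Rightarrow> 'a::zero^'d) \<Rightarrow> 'd \<Rightarrow> int \<Rightarrow> 'a" where
  "coef F i j = (if j < 0 then 0 else F (nat j) $ i)"

definition spectrum_of :: "(nat \<Rightarrow> 'a::zero^'d) \<Rightarrow> 'd \<Rightarrow> int set" where
  "spectrum_of F i = {j. coef F i j \<noteq> 0}"

definition lacunary :: "nat set \<Rightarrow> bool" where
  "lacunary L \<longleftrightarrow> infinite L \<and>
     (\<exists>c::real. c > 1 \<and> (\<forall>k. real (enumerate L (Suc k)) \<ge> c * real (enumerate L k)))"

text \<open>orthogonal projection on the complex Hilbert space (Y, J)\<close>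
definition orth_proj :: "('b::real_inner \<Rightarrow> 'b) \<Rightarrow> ('b \<Rightarrow> 'b) \<Rightarrow> bool" where
  "orth_proj J P \<longleftrightarrow> bounded_linear P \<and> (\<forall>x. P (P x) = P x) \<and>
     (\<forall>x y. inner (P x) y = inner x (P y)) \<and> (\<forall>x. P (J x) = J (P x))"

definition completely_rel_compact :: "('b::real_inner \<Rightarrow> 'b) \<Rightarrow> (nat \<Rightarrow> 'b) \<Rightarrow> bool" where
  "completely_rel_compact J a \<longleftrightarrow>
     (\<forall>P. orth_proj J P \<longrightarrow>
        compact (closure {P (a k) /\<^sub>R norm (P (a k)) | k. P (a k) \<noteq> 0}))"

end

theory Submission
  imports Defs
begin

text \<open>
  Write \<open>a k\<close> for the \<open>k\<close>-th vector of the theorem. If \<open>y\<close> is orthogonal to all \<open>a k\<close> with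
  \<open>k \<ge> N\<close>, then the function with coordinates \<open>y i * z ^ (R + m i)\<close>, \<open>R\<close> large, is orthogonal
  to the orbit of \<open>f\<close>. Conversely, let \<open>G\<close> be orthogonal to the orbit and align its
  coefficients with those of \<open>f\<close>, \<open>b j = (G i (j + m i)) i\<close>, so that
  \<open>\<Sum>k. \<langle>a k, b (k - n)\<rangle> = 0\<close> for all \<open>n \<ge> 0\<close>. Let \<open>P\<close> project onto the closed span of the
  \<open>b j\<close>, let \<open>l\<close> enumerate \<open>\<Lambda>\<close>, put \<open>x s = P (a (l s))\<close> and
  \<open>r s = \<Sum>t\<ge>s. \<parallel>x t\<parallel>\<^sup>2\<close>. Taking \<open>n = l s - j\<close> isolates \<open>\<langle>x s, b j\<rangle>\<close>, and Cauchy-Schwarz gives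
  \<open>\<langle>x s, b j\<rangle>\<^sup>2 \<le> r (s + 1) * \<beta> s\<close> with \<open>\<beta> s = \<Sum>t>s. \<parallel>b (l t - l s + j)\<parallel>\<^sup>2\<close>. By lacunarity
  every integer is a difference \<open>l t - l s\<close> boundedly often, so \<open>\<beta>\<close> is summable. Relative
  compactness of the normalised \<open>x s\<close> bounds finitely many of the \<open>\<langle>x s, b j\<rangle>\<close> from below
  jointly by a multiple of \<open>\<parallel>x s\<parallel>\<close>, so \<open>\<Sum>s. \<parallel>x s\<parallel>\<^sup>2 / r (s + 1)\<close> converges. Since such a series
  of terms over tails always diverges, \<open>x s = 0\<close> eventually; then every \<open>b j\<close> is orthogonal to
  a tail of the sequence \<open>a\<close>, hence zero.
\<close>

section \<open>Orthogonal projections in real Hilbert spaces\<close>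

lemma norm_diff_scaleR_power2:
  fixes u v :: "'b::real_inner"
  shows "(norm (u - t *\<^sub>R v))\<^sup>2 = (norm u)\<^sup>2 - 2 * t * inner u v + t\<^sup>2 * (norm v)\<^sup>2"
  unfolding power2_norm_eq_inner
  by (simp add: inner_diff inner_commute power2_eq_square algebra_simps)

text \<open>A quadratic polynomial in \<open>t\<close> that is minimal at 0 has no linear term; the
  proof tests it at its vertex.\<close>

lemma orthogonal_if_minimal:
  fixes u v :: "'b::real_inner"
  assumes "\<And>t. (norm u)\<^sup>2 \<le> (norm (u - t *\<^sub>R v))\<^sup>2"
  shows "inner u v = 0"
proof (cases "v = 0")
  case False
  then have v: "(norm v)\<^sup>2 > 0" by simp
  define t where "t = inner u v / (norm v)\<^sup>2"
  have "2 * t * inner u v \<le> t\<^sup>2 * (norm v)\<^sup>2"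
    using assms[of t] unfolding norm_diff_scaleR_power2 by linarith
  moreover have "t\<^sup>2 * (norm v)\<^sup>2 = t * inner u v"
    using v by (simp add: t_def power2_eq_square)
  moreover have "t * inner u v = (inner u v)\<^sup>2 / (norm v)\<^sup>2"
    by (simp add: t_def power2_eq_square)
  ultimately have "(inner u v)\<^sup>2 / (norm v)\<^sup>2 \<le> 0" by linarith
  then show ?thesis using v by (simp add: divide_le_0_iff)
qed simp

text \<open>A minimising sequence for the distance from \<open>x\<close> to \<open>S\<close> is
  Cauchy by the parallelogram law, since midpoints stay in \<open>S\<close>. Its limit attains the
  infimum, and minimality along each line through the limit gives orthogonality.\<close>

lemma closed_subspace_orthogonal_projection:
  fixes S :: "'b::{real_inner, complete_space} set"
  assumes S: "subspace S" "closed S"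
  obtains q where "q \<in> S" "\<And>w. w \<in> S \<Longrightarrow> inner (x - q) w = 0"
proof -
  define D where "D = (INF w\<in>S. (norm (x - w))\<^sup>2)"
  have ne: "S \<noteq> {}" using subspace_0[OF S(1)] by auto
  have bdd: "bdd_below ((\<lambda>w. (norm (x - w))\<^sup>2) ` S)"
    by (rule bdd_belowI[of _ 0]) auto
  have D_le: "D \<le> (norm (x - w))\<^sup>2" if "w \<in> S" for w
    unfolding D_def by (rule cINF_lower[OF bdd that])
  have "\<exists>w\<in>S. (norm (x - w))\<^sup>2 < D + 1 / real (Suc n)" for n
    using cINF_less_iff[OF ne bdd, of "D + 1 / real (Suc n)"] by (auto simp: D_def)
  then obtain y where y: "y n \<in> S" "(norm (x - y n))\<^sup>2 < D + 1 / real (Suc n)" for n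
    by metis
  have par: "(norm (y m - y n))\<^sup>2 < 2 / real (Suc m) + 2 / real (Suc n)" for m n
  proof -
    have "(1/2) *\<^sub>R (y m + y n) \<in> S"
      using S(1) y(1) by (simp add: subspace_add subspace_scale)
    then have "D \<le> (norm (x - (1/2) *\<^sub>R (y m + y n)))\<^sup>2" by (rule D_le)
    moreover have "(norm (y m - y n))\<^sup>2 = 2 * (norm (x - y m))\<^sup>2 + 2 * (norm (x - y n))\<^sup>2
        - 4 * (norm (x - (1/2) *\<^sub>R (y m + y n)))\<^sup>2"
      by (simp add: power2_norm_eq_inner inner_diff inner_add inner_commute algebra_simps)
    ultimately show ?thesis using y(2)[of m] y(2)[of n] by linarith
  qed
  have "Cauchy y"
  proof (rule metric_CauchyI)
    fix e :: real assume e: "e > 0"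
    obtain M where M: "4 / e\<^sup>2 < real M" using reals_Archimedean2 by blast
    have "dist (y m) (y n) < e" if "m \<ge> M" "n \<ge> M" for m n
    proof -
      have M0: "real M > 0" using M e by (meson divide_pos_pos less_trans zero_less_numeral zero_less_power)
      have "2 / real (Suc m) \<le> 2 / real M" "2 / real (Suc n) \<le> 2 / real M"
        using that M0 by (auto intro!: divide_left_mono)
      moreover have "4 / real M < e\<^sup>2" using M e M0 by (simp add: field_simps)
      ultimately have "(norm (y m - y n))\<^sup>2 < e\<^sup>2" using par[of m n] by simp
      then show ?thesis using e by (simp add: dist_norm power2_less_imp_less)
    qed
    then show "\<exists>M. \<forall>m\<ge>M. \<forall>n\<ge>M. dist (y m) (y n) < e" by blast
  qed
  then obtain q where q: "y \<longlonglongrightarrow> q" using Cauchy_convergent convergent_def by blast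
  have qS: "q \<in> S" using closed_sequentially[OF S(2) y(1) q] .
  have "(\<lambda>n. (norm (x - y n))\<^sup>2) \<longlonglongrightarrow> (norm (x - q))\<^sup>2"
    by (intro tendsto_intros q)
  moreover have "(\<lambda>n. D + 1 / real (Suc n)) \<longlonglongrightarrow> D + 0"
    by (intro tendsto_intros LIMSEQ_inverse_real_of_nat[unfolded inverse_eq_divide])
  ultimately have qD: "(norm (x - q))\<^sup>2 \<le> D"
    using y(2) by (intro LIMSEQ_le[of _ _ _ D]) (auto intro: less_imp_le)
  have "inner (x - q) w = 0" if "w \<in> S" for w
  proof (rule orthogonal_if_minimal)
    fix t
    have "q + t *\<^sub>R w \<in> S" using S(1) qS that by (simp add: subspace_add subspace_scale)
    from order_trans[OF qD D_le[OF this]] show "(norm (x - q))\<^sup>2 \<le> (norm (x - q - t *\<^sub>R w))\<^sup>2"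
      unfolding diff_diff_add .
  qed
  with qS that show thesis by blast
qed

lemma subspace_closure_real_normed:
  fixes S :: "'b::real_normed_vector set"
  assumes "subspace S"
  shows "subspace (closure S)"
proof (rule subspaceI)
  show "0 \<in> closure S" using subspace_0[OF assms] closure_subset by blast
next
  fix x y assume "x \<in> closure S" "y \<in> closure S"
  then obtain f g where "\<And>n. f n \<in> S" "f \<longlonglongrightarrow> x" "\<And>n. g n \<in> S" "g \<longlonglongrightarrow> y"
    unfolding closure_sequential by metis
  then have "\<And>n. f n + g n \<in> S" "(\<lambda>n. f n + g n) \<longlonglongrightarrow> x + y"
    by (auto intro: subspace_add[OF assms] tendsto_add)
  then show "x + y \<in> closure S" unfolding closure_sequential by (intro exI[of _ "\<lambda>n. f n + g n"]) simp
next
  fix c x assume "x \<in> closure S"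
  then obtain f where "\<And>n. f n \<in> S" "f \<longlonglongrightarrow> x"
    unfolding closure_sequential by metis
  then have "\<And>n. c *\<^sub>R f n \<in> S" "(\<lambda>n. c *\<^sub>R f n) \<longlonglongrightarrow> c *\<^sub>R x"
    by (auto intro: subspace_scale[OF assms] tendsto_scaleR)
  then show "c *\<^sub>R x \<in> closure S" unfolding closure_sequential by (intro exI[of _ "\<lambda>n. c *\<^sub>R f n"]) simp
qed

text \<open>Forward, \<open>y\<close> itself is approximated from \<open>S\<close>, which forces
  \<open>inner y y = 0\<close>. Backward, the residual of projecting \<open>x\<close> onto the
  closure is orthogonal to \<open>S\<close>, hence zero.\<close>

lemma dense_subspace_iff_orthogonal_trivial:
  fixes S :: "'b::{real_inner, complete_space} set"
  assumes "subspace S"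
  shows "closure S = UNIV \<longleftrightarrow> (\<forall>y. (\<forall>w\<in>S. inner w y = 0) \<longrightarrow> y = 0)"
proof (intro iffI allI impI)
  fix y assume dense: "closure S = UNIV" and orth: "\<forall>w\<in>S. inner w y = 0"
  obtain f where f: "\<And>n. f n \<in> S" "f \<longlonglongrightarrow> y"
    using dense unfolding closure_sequential set_eq_iff by blast
  have "(\<lambda>n. inner (f n) y) \<longlonglongrightarrow> inner y y" by (intro tendsto_intros f)
  then show "y = 0" using f(1) orth LIMSEQ_unique[of "\<lambda>n. 0" 0 "inner y y"] by simp
next
  assume triv: "\<forall>y. (\<forall>w\<in>S. inner w y = 0) \<longrightarrow> y = 0"
  have "x \<in> closure S" for x
  proof -
    obtain q where q: "q \<in> closure S" "\<And>w. w \<in> closure S \<Longrightarrow> inner (x - q) w = 0"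
      using closed_subspace_orthogonal_projection[OF subspace_closure_real_normed[OF assms] closed_closure, of x] by blast
    have "\<forall>w\<in>S. inner w (x - q) = 0" using q(2) closure_subset inner_commute by (metis subsetD)
    then have "x = q" using triv by fastforce
    with q(1) show ?thesis by simp
  qed
  then show "closure S = UNIV" by auto
qed

section \<open>The Hilbert space of square-summable sequences\<close>

lemma H2_summable_inner:
  fixes f g :: "nat \<Rightarrow> 'b::real_inner"
  assumes "H2 f" "H2 g"
  shows "summable (\<lambda>k. norm (inner (f k) (g k)))"
proof (rule summable_comparison_test)
  show "summable (\<lambda>k. (norm (f k))\<^sup>2 + (norm (g k))\<^sup>2)"
    using assms unfolding H2_def by (rule summable_add)
  have "norm (norm (inner (f k) (g k))) \<le> (norm (f k))\<^sup>2 + (norm (g k))\<^sup>2" for k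
  proof -
    have "\<bar>inner (f k) (g k)\<bar> \<le> norm (f k) * norm (g k)" by (rule Cauchy_Schwarz_ineq2)
    moreover have "2 * (norm (f k) * norm (g k)) \<le> (norm (f k))\<^sup>2 + (norm (g k))\<^sup>2"
      using sum_squares_bound[of "norm (f k)" "norm (g k)"] by simp
    moreover have "0 \<le> norm (f k) * norm (g k)" by simp
    ultimately have "\<bar>inner (f k) (g k)\<bar> \<le> (norm (f k))\<^sup>2 + (norm (g k))\<^sup>2" by linarith
    then show ?thesis by simp
  qed
  then show "\<exists>N. \<forall>k\<ge>N. norm (norm (inner (f k) (g k))) \<le> (norm (f k))\<^sup>2 + (norm (g k))\<^sup>2" by blast
qed

lemma H2_0: "H2 (\<lambda>k. 0)" by (simp add: H2_def)

lemma H2_add: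
  fixes f g :: "nat \<Rightarrow> 'b::real_normed_vector"
  assumes "H2 f" "H2 g" shows "H2 (\<lambda>k. f k + g k)"
  unfolding H2_def
proof (rule summable_comparison_test)
  show "summable (\<lambda>k. 2 * ((norm (f k))\<^sup>2 + (norm (g k))\<^sup>2))"
    using assms unfolding H2_def by (intro summable_mult summable_add)
  have "norm ((norm (f k + g k))\<^sup>2) \<le> 2 * ((norm (f k))\<^sup>2 + (norm (g k))\<^sup>2)" for k
  proof -
    have "(norm (f k + g k))\<^sup>2 \<le> (norm (f k) + norm (g k))\<^sup>2"
      by (intro power_mono norm_triangle_ineq norm_ge_zero)
    also have "\<dots> \<le> 2 * ((norm (f k))\<^sup>2 + (norm (g k))\<^sup>2)"
      using sum_squares_bound[of "norm (f k)" "norm (g k)"] by (simp add: power2_sum)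
    finally show ?thesis by simp
  qed
  then show "\<exists>N. \<forall>k\<ge>N. norm ((norm (f k + g k))\<^sup>2) \<le> 2 * ((norm (f k))\<^sup>2 + (norm (g k))\<^sup>2)" by blast
qed

lemma H2_scaleR: "H2 f \<Longrightarrow> H2 (\<lambda>k. c *\<^sub>R f k)"
  unfolding H2_def by (simp add: power_mult_distrib summable_mult)

lemma H2_minus: "H2 f \<Longrightarrow> H2 (\<lambda>k. - f k)"
  unfolding H2_def by simp

lemma H2_diff: "H2 f \<Longrightarrow> H2 g \<Longrightarrow> H2 (\<lambda>k. f k - g k)"
  using H2_add[OF _ H2_minus] by fastforce

lemma H2_bshift: "H2 f \<Longrightarrow> H2 (bshift n f)"
  unfolding H2_def bshift_def by (rule summable_ignore_initial_segment)

text \<open>Making the square-summable sequences a type allows the density criterion, stated for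
  Hilbert space type classes, to be applied to them.\<close>

typedef (overloaded) 'b l2 = "{f :: nat \<Rightarrow> 'b::real_normed_vector. H2 f}"
  morphisms l2_coeff l2_of
  using H2_0 by blast

setup_lifting type_definition_l2

lemma H2_l2_coeff: "H2 (l2_coeff f)"
  using l2_coeff by blast

lemma l2_coeff_of: "H2 f \<Longrightarrow> l2_coeff (l2_of f) = f"
  by (simp add: l2_of_inverse)

instantiation l2 :: (real_inner) real_inner
begin

lift_definition zero_l2 :: "'a l2" is "\<lambda>k. 0" by (rule H2_0)
lift_definition plus_l2 :: "'a l2 \<Rightarrow> 'a l2 \<Rightarrow> 'a l2" is "\<lambda>f g k. f k + g k" by (rule H2_add)
lift_definition minus_l2 :: "'a l2 \<Rightarrow> 'a l2 \<Rightarrow> 'a l2" is "\<lambda>f g k. f k - g k" by (rule H2_diff)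
lift_definition uminus_l2 :: "'a l2 \<Rightarrow> 'a l2" is "\<lambda>f k. - f k" by (rule H2_minus)
lift_definition scaleR_l2 :: "real \<Rightarrow> 'a l2 \<Rightarrow> 'a l2" is "\<lambda>c f k. c *\<^sub>R f k" by (rule H2_scaleR)
lift_definition inner_l2 :: "'a l2 \<Rightarrow> 'a l2 \<Rightarrow> real" is "\<lambda>f g. \<Sum>k. inner (f k) (g k)" .
definition norm_l2 :: "'a l2 \<Rightarrow> real" where "norm_l2 f = sqrt (inner f f)"
definition sgn_l2 :: "'a l2 \<Rightarrow> 'a l2" where "sgn_l2 f = inverse (norm f) *\<^sub>R f"
definition dist_l2 :: "'a l2 \<Rightarrow> 'a l2 \<Rightarrow> real" where "dist_l2 f g = norm (f - g)"
definition uniformity_l2 :: "('a l2 \<times> 'a l2) filter" where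
  "uniformity_l2 = (INF e\<in>{0 <..}. principal {(x, y). dist x y < e})"
definition open_l2 :: "'a l2 set \<Rightarrow> bool" where
  "open_l2 U \<longleftrightarrow> (\<forall>x\<in>U. eventually (\<lambda>(x', y). x' = x \<longrightarrow> y \<in> U) uniformity)"

instance
proof
  fix f g h :: "'a l2" and a b :: real
  show "f + g + h = f + (g + h)" by transfer (simp add: add.assoc)
  show "f + g = g + f" by transfer (simp add: add.commute)
  show "0 + f = f" by transfer simp
  show "- f + f = 0" by transfer simp
  show "f - g = f + - g" by transfer simp
  show "a *\<^sub>R (f + g) = a *\<^sub>R f + a *\<^sub>R g" by transfer (simp add: scaleR_add_right)
  show "(a + b) *\<^sub>R f = a *\<^sub>R f + b *\<^sub>R f" by transfer (simp add: scaleR_add_left)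
  show "a *\<^sub>R b *\<^sub>R f = (a * b) *\<^sub>R f" by transfer simp
  show "1 *\<^sub>R f = f" by transfer simp
  show "sgn f = inverse (norm f) *\<^sub>R f" by (simp add: sgn_l2_def)
  show "dist f g = norm (f - g)" by (rule dist_l2_def)
  show "uniformity = (INF e\<in>{0 <..}. principal {(x :: 'a l2, y). dist x y < e})"
    by (rule uniformity_l2_def)
  show "open U \<longleftrightarrow> (\<forall>x\<in>U. eventually (\<lambda>(x', y). x' = x \<longrightarrow> y \<in> U) uniformity)" for U :: "'a l2 set"
    by (rule open_l2_def)
  show "inner f g = inner g f" by transfer (simp add: inner_commute)
  show "inner (f + g) h = inner f h + inner g h"
    by transfer (simp add: inner_add_left suminf_add summable_norm_cancel[OF H2_summable_inner])
  show "inner (a *\<^sub>R f) g = a * inner f g"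
    by transfer (simp add: suminf_mult summable_norm_cancel[OF H2_summable_inner])
  show "0 \<le> inner f f"
    by transfer (simp add: suminf_nonneg summable_norm_cancel[OF H2_summable_inner])
  show "inner f f = 0 \<longleftrightarrow> f = 0"
    by transfer (simp add: suminf_eq_zero_iff summable_norm_cancel[OF H2_summable_inner] fun_eq_iff)
  show "norm f = sqrt (inner f f)" by (rule norm_l2_def)
qed

end

lemma norm_l2_eq_H2_norm: "norm f = H2_norm (l2_coeff f)"
  by (simp add: norm_l2_def inner_l2.rep_eq H2_norm_def power2_norm_eq_inner)

lemma norm_l2_power2: "(norm f)\<^sup>2 = (\<Sum>k. (norm (l2_coeff f k))\<^sup>2)"
  by (simp add: power2_norm_eq_inner inner_l2.rep_eq)

lemma norm_l2_coeff_le: "norm (l2_coeff f k) \<le> norm f"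
proof (rule power2_le_imp_le)
  have "(\<Sum>j\<in>{k}. (norm (l2_coeff f j))\<^sup>2) \<le> (\<Sum>j. (norm (l2_coeff f j))\<^sup>2)"
    using H2_l2_coeff[of f, unfolded H2_def] by (rule sum_le_suminf) auto
  then show "(norm (l2_coeff f k))\<^sup>2 \<le> (norm f)\<^sup>2" by (simp add: norm_l2_power2)
qed simp

text \<open>Coordinates are contractions, so coordinatewise limits exist; the Cauchy bound passes to
  the limit in every finite partial sum and hence to the whole sum.\<close>

instance l2 :: ("{real_inner, complete_space}") complete_space
proof
  fix X :: "nat \<Rightarrow> 'a l2" assume X: "Cauchy X"
  have "Cauchy (\<lambda>n. l2_coeff (X n) k)" for k
  proof (rule metric_CauchyI)
    fix e :: real assume "e > 0"
    then obtain M where M: "\<forall>m\<ge>M. \<forall>n\<ge>M. dist (X m) (X n) < e" using X metric_CauchyD by blast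
    have "dist (l2_coeff (X m) k) (l2_coeff (X n) k) < e" if "m \<ge> M" "n \<ge> M" for m n
      using norm_l2_coeff_le[of "X m - X n" k] M that
      by (fastforce simp: dist_norm minus_l2.rep_eq)
    then show "\<exists>M. \<forall>m\<ge>M. \<forall>n\<ge>M. dist (l2_coeff (X m) k) (l2_coeff (X n) k) < e" by blast
  qed
  then have "\<exists>l. (\<lambda>n. l2_coeff (X n) k) \<longlonglongrightarrow> l" for k
    using Cauchy_convergent convergent_def by blast
  then obtain f where f: "\<And>k. (\<lambda>n. l2_coeff (X n) k) \<longlonglongrightarrow> f k" by metis
  have tail: "\<exists>M. \<forall>n\<ge>M. H2 (\<lambda>k. f k - l2_coeff (X n) k) \<and>
      H2_norm (\<lambda>k. f k - l2_coeff (X n) k) \<le> e" if e: "e > 0" for e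
  proof -
    obtain M where M: "\<forall>m\<ge>M. \<forall>n\<ge>M. dist (X m) (X n) < e" using X e metric_CauchyD by blast
    have "H2 (\<lambda>k. f k - l2_coeff (X n) k) \<and> H2_norm (\<lambda>k. f k - l2_coeff (X n) k) \<le> e"
      if n: "n \<ge> M" for n
    proof -
      have fin: "(\<Sum>k<K. (norm (f k - l2_coeff (X n) k))\<^sup>2) \<le> e\<^sup>2" for K
      proof (rule LIMSEQ_le_const2)
        show "(\<lambda>p. \<Sum>k<K. (norm (l2_coeff (X p) k - l2_coeff (X n) k))\<^sup>2)
            \<longlonglongrightarrow> (\<Sum>k<K. (norm (f k - l2_coeff (X n) k))\<^sup>2)"
          by (intro tendsto_intros f)
        have "(\<Sum>k<K. (norm (l2_coeff (X p) k - l2_coeff (X n) k))\<^sup>2) \<le> e\<^sup>2" if "p \<ge> M" for p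
        proof -
          have "(\<Sum>k<K. (norm (l2_coeff (X p - X n) k))\<^sup>2) \<le> (norm (X p - X n))\<^sup>2"
            unfolding norm_l2_power2
            using H2_l2_coeff[of "X p - X n", unfolded H2_def] by (rule sum_le_suminf) auto
          also have "\<dots> \<le> e\<^sup>2"
            using M n that by (intro power_mono) (auto simp: dist_norm intro: less_imp_le)
          finally show ?thesis by (simp add: minus_l2.rep_eq)
        qed
        then show "\<exists>N. \<forall>p\<ge>N. (\<Sum>k<K. (norm (l2_coeff (X p) k - l2_coeff (X n) k))\<^sup>2) \<le> e\<^sup>2"
          by blast
      qed
      have s: "summable (\<lambda>k. (norm (f k - l2_coeff (X n) k))\<^sup>2)"
        by (rule summableI_nonneg_bounded[OF _ fin]) simp
      moreover have "(\<Sum>k. (norm (f k - l2_coeff (X n) k))\<^sup>2) \<le> e\<^sup>2"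
        by (rule suminf_le_const[OF s fin])
      ultimately show ?thesis using e by (simp add: H2_def H2_norm_def real_le_lsqrt)
    qed
    then show ?thesis by blast
  qed
  \<comment> \<open>The limit is square-summable because it is a single \<open>X M\<close> plus the
    square-summable difference to it.\<close>
  obtain M where "H2 (\<lambda>k. f k - l2_coeff (X M) k)" using tail[of 1] by force
  from H2_add[OF this H2_l2_coeff[of "X M"]] have f2: "H2 f" by simp
  have "X \<longlonglongrightarrow> l2_of f"
  proof (rule metric_LIMSEQ_I)
    fix e :: real assume "e > 0"
    then obtain M where M: "\<forall>n\<ge>M. H2_norm (\<lambda>k. f k - l2_coeff (X n) k) \<le> e / 2"
      using tail[of "e / 2"] by auto
    have "dist (X n) (l2_of f) < e" if "n \<ge> M" for n
    proof -
      have "dist (X n) (l2_of f) = H2_norm (\<lambda>k. f k - l2_coeff (X n) k)"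
        by (simp add: dist_norm norm_l2_eq_H2_norm minus_l2.rep_eq l2_coeff_of f2 H2_norm_def norm_minus_commute)
      then show ?thesis using M that \<open>e > 0\<close> by fastforce
    qed
    then show "\<exists>N. \<forall>n\<ge>N. dist (X n) (l2_of f) < e" by blast
  qed
  then show "convergent X" unfolding convergent_def by blast
qed

section \<open>Lacunary sequences and sums over tails\<close>

text \<open>The inequality for finite sums passes to the limit along the finite subsets of
  \<open>A\<close>.\<close>

lemma has_sum_inner_Cauchy_Schwarz:
  fixes f g :: "'i \<Rightarrow> 'b::real_inner"
  assumes S: "((\<lambda>t. inner (f t) (g t)) has_sum S) A"
    and f: "(\<lambda>t. (norm (f t))\<^sup>2) summable_on A"
    and g: "(\<lambda>t. (norm (g t))\<^sup>2) summable_on A"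
  shows "S\<^sup>2 \<le> (\<Sum>\<^sub>\<infinity>t\<in>A. (norm (f t))\<^sup>2) * (\<Sum>\<^sub>\<infinity>t\<in>A. (norm (g t))\<^sup>2)"
proof (rule tendsto_upperbound)
  show "((\<lambda>X. (\<Sum>t\<in>X. inner (f t) (g t))\<^sup>2) \<longlongrightarrow> S\<^sup>2) (finite_subsets_at_top A)"
    using S unfolding has_sum_def by (rule tendsto_power)
  show "\<forall>\<^sub>F X in finite_subsets_at_top A. (\<Sum>t\<in>X. inner (f t) (g t))\<^sup>2
      \<le> (\<Sum>\<^sub>\<infinity>t\<in>A. (norm (f t))\<^sup>2) * (\<Sum>\<^sub>\<infinity>t\<in>A. (norm (g t))\<^sup>2)"
  proof (rule eventually_finite_subsets_at_top_weakI)
    fix X assume X: "finite X" "X \<subseteq> A"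
    have "\<bar>\<Sum>t\<in>X. inner (f t) (g t)\<bar> \<le> (\<Sum>t\<in>X. norm (f t) * norm (g t))"
      by (rule order_trans[OF sum_abs]) (intro sum_mono Cauchy_Schwarz_ineq2)
    from power_mono[OF this abs_ge_zero, of 2]
    have "(\<Sum>t\<in>X. inner (f t) (g t))\<^sup>2 \<le> (\<Sum>t\<in>X. norm (f t) * norm (g t))\<^sup>2"
      by simp
    also have "\<dots> \<le> (\<Sum>t\<in>X. (norm (f t))\<^sup>2) * (\<Sum>t\<in>X. (norm (g t))\<^sup>2)"
      by (rule Cauchy_Schwarz_ineq_sum)
    also have "\<dots> \<le> (\<Sum>\<^sub>\<infinity>t\<in>A. (norm (f t))\<^sup>2) * (\<Sum>\<^sub>\<infinity>t\<in>A. (norm (g t))\<^sup>2)"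
      by (intro mult_mono finite_sum_le_infsum f g X infsum_nonneg sum_nonneg) auto
    finally show "(\<Sum>t\<in>X. inner (f t) (g t))\<^sup>2
      \<le> (\<Sum>\<^sub>\<infinity>t\<in>A. (norm (f t))\<^sup>2) * (\<Sum>\<^sub>\<infinity>t\<in>A. (norm (g t))\<^sup>2)" .
  qed
qed simp

lemma infsum_atLeast_Suc:
  fixes h :: "nat \<Rightarrow> real"
  assumes "h summable_on UNIV"
  shows "infsum h {s..} = h s + infsum h {Suc s..}"
proof -
  have "{s..} = insert s {Suc s..}" by auto
  then show ?thesis
    using infsum_insert[of h "{Suc s..}" s] summable_on_subset[OF assms, of "{Suc s..}"] by auto
qed

text \<open>The logarithms of the tails telescope, and they tend to \<open>-\<infinity>\<close>.\<close>

lemma not_summable_divide_tail: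
  fixes h :: "nat \<Rightarrow> real"
  assumes h: "h summable_on UNIV" "\<And>s. h s \<ge> 0"
    and pos: "\<And>s. infsum h {s..} > 0"
  shows "\<not> summable (\<lambda>s. h s / infsum h {Suc s..})"
proof
  define r where "r s = infsum h {s..}" for s
  have r: "r s = h s + r (Suc s)" "r s > 0" for s
    unfolding r_def by (rule infsum_atLeast_Suc[OF h(1)]) (rule pos)
  assume "summable (\<lambda>s. h s / infsum h {Suc s..})"
  then have sm: "summable (\<lambda>s. h s / r (Suc s))" by (simp add: r_def)
  define C where "C = (\<Sum>s. h s / r (Suc s))"
  have le: "(\<Sum>s<n. h s / r (Suc s)) \<le> C" for n
    unfolding C_def using sm by (rule sum_le_suminf) (auto simp: h(2) r(2) less_imp_le)
  have "ln (r 0) - ln (r n) \<le> (\<Sum>s<n. h s / r (Suc s))" for n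
  proof (induction n)
    case (Suc n)
    have "ln (r n) - ln (r (Suc n)) = ln (r n / r (Suc n))"
      using r(2)[of n] r(2)[of "Suc n"] by (simp add: ln_div)
    also have "r n / r (Suc n) = 1 + h n / r (Suc n)"
      using r(1)[of n] r(2)[of "Suc n"] by (simp add: field_simps)
    also have "ln \<dots> \<le> h n / r (Suc n)"
      by (rule ln_add_one_self_le_self) (simp add: h(2) r(2) less_imp_le)
    finally show ?case using Suc by simp
  qed simp
  \<comment> \<open>A convergent series of quotients would keep all tails above one positive
    constant, although the tails of the summable \<open>h\<close> tend to 0.\<close>
  then have lower: "r n \<ge> exp (ln (r 0) - C)" for n
    using le[of n] r(2)[of n] by (smt (verit) exp_le_cancel_iff exp_ln)
  have "(\<Sum>s<n. h s) + r n = r 0" for n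
  proof (induction n)
    case (Suc n)
    then show ?case using r(1)[of n] by simp
  qed simp
  then have r_eq: "r = (\<lambda>n. r 0 - (\<Sum>s<n. h s))" by (auto simp: fun_eq_iff algebra_simps)
  have "(\<lambda>n. \<Sum>s<n. h s) \<longlonglongrightarrow> r 0"
    using has_sum_imp_sums[OF has_sum_infsum[OF h(1)]] by (simp add: sums_def r_def atLeast_0)
  then have "(\<lambda>n. r 0 - (\<Sum>s<n. h s)) \<longlonglongrightarrow> r 0 - r 0" by (intro tendsto_diff tendsto_const)
  then have "r \<longlonglongrightarrow> 0" by (subst r_eq) simp
  then have "exp (ln (r 0) - C) \<le> 0" using lower by (intro LIMSEQ_le_const) auto
  then show False using exp_gt_zero[of "ln (r 0) - C"] by linarith
qed

lemma lacunary_power_le: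
  fixes l :: "nat \<Rightarrow> nat"
  assumes "c > 1" "\<And>k. real (l (Suc k)) \<ge> c * real (l k)"
  shows "c ^ p * real (l t) \<le> real (l (t + p))"
proof (induction p)
  case (Suc p)
  have "c ^ Suc p * real (l t) = c * (c ^ p * real (l t))" by simp
  also have "\<dots> \<le> c * real (l (t + p))" using Suc assms(1) by (intro mult_left_mono) auto
  also have "\<dots> \<le> real (l (t + Suc p))" using assms(2)[of "t + p"] by simp
  finally show ?case .
qed simp

lemma lacunary_less_le:
  fixes l :: "nat \<Rightarrow> nat"
  assumes "\<And>k. real (l (Suc k)) \<ge> c * real (l k)" "strict_mono l" "s < t"
  shows "c * real (l s) \<le> real (l t)"
proof -
  have "l (Suc s) \<le> l t" using assms(2,3) by (simp add: strict_mono_less_eq)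
  then show ?thesis using assms(1)[of s] by linarith
qed

text \<open>A given integer has boundedly many representations as a difference of two terms of a
  lacunary sequence: for \<open>p\<close> large, the larger index \<open>t\<close> is determined by the difference and
  by \<open>t mod p\<close>.\<close>

lemma summable_on_lacunary_differences:
  fixes l :: "nat \<Rightarrow> nat" and g :: "int \<Rightarrow> real"
  assumes c: "c > 1" and lac: "\<And>k. real (l (Suc k)) \<ge> c * real (l k)" and mono: "strict_mono l"
    and g: "g summable_on UNIV"
  shows "(\<lambda>(s, t). g (int (l t) - int (l s) + j)) summable_on (SIGMA s:UNIV. {s<..})"
proof -
  \<comment> \<open>With this \<open>p\<close>, advancing the index by \<open>p\<close> multiplies
    \<open>l\<close> by more than \<open>c / (c - 1)\<close>, the factor needed to outweigh the
    subtracted term \<open>l s'\<close> below.\<close>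
  obtain p where p: "c / (c - 1) < c ^ p" using real_arch_pow[OF c] by blast
  have p0: "p > 0"
  proof (rule ccontr)
    assume "\<not> p > 0"
    with p c show False by (simp add: field_simps)
  qed
  define A where "A \<rho> = {(s, t). s < t \<and> t mod p = \<rho>}" for \<rho>
  define d where "d = (\<lambda>(s, t). int (l t) - int (l s) + j)"
  \<comment> \<open>If \<open>t < t'\<close> in the same residue class, then
    \<open>t + p \<le> t'\<close>, and
    \<open>l t' - l s' \<ge> (1 - 1 / c) * l t' > l t \<ge> l t - l s\<close>, so the differences
    cannot agree.\<close>
  have lt: "t' \<le> t" if "(s, t) \<in> A \<rho>" "(s', t') \<in> A \<rho>" "d (s, t) = d (s', t')" for s t s' t' \<rho>
  proof (rule ccontr)
    assume "\<not> t' \<le> t"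
    then have "t < t'" by simp
    moreover have "t mod p = t' mod p" using that by (simp add: A_def)
    ultimately have "p dvd t' - t" using mod_eq_dvd_iff_nat[of t t' p] by simp
    with \<open>t < t'\<close> have "p \<le> t' - t" by (intro dvd_imp_le) auto
    with \<open>t < t'\<close> have "t + p \<le> t'" by simp
    then have "real (l (t + p)) \<le> real (l t')" using mono by (simp add: strict_mono_less_eq)
    with lacunary_power_le[of c l p t, OF c lac] have lp: "c ^ p * real (l t) \<le> real (l t')" by simp
    \<comment> \<open>Positivity makes the next inequality strict. It comes from
      \<open>s < t\<close>, as \<open>l 0\<close> may be 0.\<close>
    have "0 < l t" using that(1) strict_monoD[OF mono, of s t] by (simp add: A_def)
    then have "c / (c - 1) * real (l t) < c ^ p * real (l t)" using p by (intro mult_strict_right_mono) auto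
    with lp have "c / (c - 1) * real (l t) < real (l t')" by simp
    then have "c * real (l t) < (c - 1) * real (l t')" using c by (simp add: field_simps)
    moreover have "c * real (l s') \<le> real (l t')"
      using lacunary_less_le[OF lac mono] that(2) by (simp add: A_def)
    ultimately have "c * real (l t) < c * (real (l t') - real (l s'))" by (simp add: algebra_simps)
    then have "real (l t) < real (l t') - real (l s')" using c by simp
    then have "int (l t) < int (l t') - int (l s')" by linarith
    with that(3) show False by (simp add: d_def)
  qed
  have "inj_on d (A \<rho>)" for \<rho>
  proof (rule inj_onI)
    fix x y assume xy: "x \<in> A \<rho>" "y \<in> A \<rho>" "d x = d y"
    obtain s t s' t' where [simp]: "x = (s, t)" "y = (s', t')" by (cases x, cases y)
    have "t = t'" using lt[of s t \<rho> s' t'] lt[of s' t' \<rho> s t] xy by simp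
    with xy(3) have "l s = l s'" by (simp add: d_def)
    then show "x = y" using \<open>t = t'\<close> strict_mono_eq[OF mono] by simp
  qed
  then have "(g \<circ> d) summable_on A \<rho>" for \<rho>
    using summable_on_reindex[of d "A \<rho>" g] summable_on_subset[OF g, of "d ` A \<rho>"] by simp
  then have "(g \<circ> d) summable_on (\<Union>\<rho>\<in>{..<p}. A \<rho>)"
    by (intro summable_on_finite_union_disjoint) (auto simp: A_def)
  moreover have "(\<Union>\<rho>\<in>{..<p}. A \<rho>) = (SIGMA s:UNIV. {s<..})" using p0 by (auto simp: A_def)
  moreover have "g \<circ> d = (\<lambda>(s, t). g (int (l t) - int (l s) + j))" by (auto simp: d_def fun_eq_iff)
  ultimately show ?thesis by simp
qed

text \<open>The equation for \<open>n = l s - j\<close> has \<open>inner (x s) (b j)\<close> as its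
  term at \<open>t = s\<close>. For large \<open>s\<close> the gap below \<open>l s\<close> pushes
  the indices of all earlier terms under \<open>- M\<close>, where \<open>b\<close> vanishes, so
  this term is minus the sum over \<open>t > s\<close>, to which Cauchy-Schwarz applies.\<close>

lemma lacunary_coefficient_quotient_summable:
  fixes l :: "nat \<Rightarrow> nat" and x :: "nat \<Rightarrow> 'b::real_inner" and b :: "int \<Rightarrow> 'b"
  assumes c: "c > 1" and lac: "\<And>k. real (l (Suc k)) \<ge> c * real (l k)" and mono: "strict_mono l"
    and x: "(\<lambda>t. (norm (x t))\<^sup>2) summable_on UNIV"
    and b: "(\<lambda>i. (norm (b i))\<^sup>2) summable_on UNIV"
    and b0: "\<And>i. i < - M \<Longrightarrow> b i = 0"
    and eq: "\<And>n::nat. ((\<lambda>t. inner (x t) (b (int (l t) - int n))) has_sum 0) UNIV"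
    and pos: "\<And>s. (\<Sum>\<^sub>\<infinity>t\<in>{s..}. (norm (x t))\<^sup>2) > 0"
  shows "summable (\<lambda>s. (inner (x s) (b j))\<^sup>2 / (\<Sum>\<^sub>\<infinity>t\<in>{Suc s..}. (norm (x t))\<^sup>2))"
proof -
  let ?g = "\<lambda>s t. (norm (b (int (l t) - int (l s) + j)))\<^sup>2"
  define \<beta> where "\<beta> s = (\<Sum>\<^sub>\<infinity>t\<in>{s<..}. ?g s t)" for s
  have pairs: "(\<lambda>(s, t). ?g s t) summable_on (SIGMA s:UNIV. {s<..})"
    by (rule summable_on_lacunary_differences[OF c lac mono b])
  then have "\<beta> summable_on UNIV"
    unfolding \<beta>_def using summable_on_Sigma_banach[of ?g UNIV "\<lambda>s. {s<..}"] by simp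
  then have \<beta>: "summable \<beta>" by (rule summable_on_imp_summable)
  have g: "?g s summable_on {s<..}" for s
    using summable_on_SigmaD1[OF pairs, of s] by simp
  \<comment> \<open>For \<open>s > N\<close> the gap \<open>l s - l (s - 1)\<close> is at least
    \<open>(c - 1) * N\<close>, which this choice makes larger than
    \<open>\<bar>M\<bar> + \<bar>j\<bar>\<close>.\<close>
  obtain N :: nat where N: "(\<bar>real_of_int M\<bar> + \<bar>real_of_int j\<bar>) / (c - 1) < real N"
    using reals_Archimedean2 by blast
  have key: "(inner (x s) (b j))\<^sup>2 \<le> (\<Sum>\<^sub>\<infinity>t\<in>{Suc s..}. (norm (x t))\<^sup>2) * \<beta> s"
    if s: "s \<ge> Suc N + nat \<bar>j\<bar>" for s
  proof -
    obtain s' where s': "s = Suc s'" "s' \<ge> N" using s by (cases s) auto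
    have ls: "l s \<ge> s" "l s' \<ge> s'" using mono by (auto intro: strict_mono_imp_increasing)
    \<comment> \<open>The threshold for \<open>s\<close> includes \<open>nat \<bar>j\<bar>\<close>,
      so \<open>l s - j\<close> is nonnegative and \<open>nat\<close> truncates nothing.\<close>
    define n where "n = nat (int (l s) - j)"
    have n: "int n = int (l s) - j" using ls(1) s by (auto simp: n_def)
    let ?\<phi> = "\<lambda>t. inner (x t) (b (int (l t) - int (l s) + j))"
    have all: "(?\<phi> has_sum 0) UNIV" using eq[of n] by (simp add: n algebra_simps)
    have zero: "?\<phi> t = 0" if "t < s" for t
    proof -
      have "l t \<le> l s'" using that s' mono by (simp add: strict_mono_less_eq)
      have "\<bar>real_of_int M\<bar> + \<bar>real_of_int j\<bar> < (c - 1) * real N"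
        using N c by (simp add: field_simps)
      also have "\<dots> \<le> (c - 1) * real (l s')" using c s' ls by (intro mult_left_mono) auto
      also have "\<dots> \<le> real (l s) - real (l s')" using lac[of s'] s'(1) by (simp add: algebra_simps)
      finally have "\<bar>M\<bar> + \<bar>j\<bar> < int (l s) - int (l s')" by linarith
      then have "int (l t) - int (l s) + j < - M" using \<open>l t \<le> l s'\<close> by linarith
      then show ?thesis by (simp add: b0)
    qed
    have "(?\<phi> has_sum 0) UNIV \<longleftrightarrow> (?\<phi> has_sum 0) {s..}"
      by (rule has_sum_cong_neutral) (auto simp: zero)
    with all have "(?\<phi> has_sum 0) {s..}" by simp
    moreover have "{s..} = insert s {s<..}" by auto
    ultimately have tail: "(?\<phi> has_sum 0) (insert s {s<..})" by simp
    have xs: "(\<lambda>t. (norm (x t))\<^sup>2) summable_on {s<..}" using x by (rule summable_on_subset) simp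
    have "?\<phi> summable_on UNIV" using all has_sum_imp_summable by blast
    then have "?\<phi> summable_on {s<..}" by (rule summable_on_subset) simp
    then obtain S where S: "(?\<phi> has_sum S) {s<..}" using summable_on_def by blast
    have "(?\<phi> has_sum (?\<phi> s + S)) (insert s {s<..})" using S by (intro has_sum_insert) auto
    from has_sum_unique[OF this tail] have "inner (x s) (b j) + S = 0" by simp
    then have "inner (x s) (b j) = - S" by linarith
    then have "(inner (x s) (b j))\<^sup>2 = S\<^sup>2" by simp
    also have "\<dots> \<le> (\<Sum>\<^sub>\<infinity>t\<in>{s<..}. (norm (x t))\<^sup>2) * \<beta> s"
      unfolding \<beta>_def by (rule has_sum_inner_Cauchy_Schwarz[OF S xs g])
    also have "{s<..} = {Suc s..}" by auto
    finally show ?thesis .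
  qed
  show ?thesis
  proof (rule summable_comparison_test[OF _ \<beta>], intro exI[of _ "Suc N + nat \<bar>j\<bar>"] allI impI)
    fix s assume "Suc N + nat \<bar>j\<bar> \<le> s"
    from key[OF this] pos[of "Suc s"]
    show "norm ((inner (x s) (b j))\<^sup>2 / (\<Sum>\<^sub>\<infinity>t\<in>{Suc s..}. (norm (x t))\<^sup>2)) \<le> \<beta> s"
      by (simp add: divide_le_eq mult.commute)
  qed
qed

section \<open>Complex structures and the compactness argument\<close>

lemma complex_structure_inner_left:
  assumes "complex_structure J"
  shows "inner (J x) y = - inner x (J y)"
proof -
  have "inner x (J y) = inner (J x) (J (J y))" using assms unfolding complex_structure_def by metis
  then show ?thesis using assms by (simp add: complex_structure_def)
qed

lemma complex_structure_norm:
  assumes "complex_structure J"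
  shows "norm (J x) = norm x"
  using assms by (simp add: complex_structure_def norm_eq_sqrt_inner)

lemma complex_structure_Jvec:
  fixes J :: "'a::real_inner \<Rightarrow> 'a"
  assumes "complex_structure J"
  shows "complex_structure (Jvec J :: 'a^'d \<Rightarrow> 'a^'d)"
proof -
  have J: "linear J" "\<And>x. J (J x) = - x" "\<And>x y. inner (J x) (J y) = inner x y"
    using assms by (auto simp: complex_structure_def)
  have "linear (Jvec J :: 'a^'d \<Rightarrow> 'a^'d)"
    by (rule linearI) (simp_all add: Jvec_def vec_eq_iff linear_add[OF J(1)] linear_scale[OF J(1)])
  then show ?thesis
    by (simp add: complex_structure_def Jvec_def vec_eq_iff inner_vec_def J)
qed

text \<open>\<open>P\<close> is the identity minus the projection \<open>Q\<close> onto
  \<open>W\<close>. Each algebraic law for \<open>Q\<close>, including commutation with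
  \<open>J\<close>, follows from uniqueness of the orthogonal decomposition.\<close>

lemma orth_proj_with_kernel:
  fixes W :: "'b::{real_inner, complete_space} set"
  assumes J: "complex_structure J" and W: "subspace W" "closed W"
    and JW: "\<And>w. w \<in> W \<Longrightarrow> J w \<in> W"
  obtains P where "orth_proj J P" "\<And>x. P x = 0 \<longleftrightarrow> x \<in> W"
proof -
  have "\<exists>q. q \<in> W \<and> (\<forall>w\<in>W. inner (x - q) w = 0)" for x
    by (rule closed_subspace_orthogonal_projection[OF W, of x]) blast
  then obtain Q where Q: "Q x \<in> W" "\<And>w. w \<in> W \<Longrightarrow> inner (x - Q x) w = 0" for x
    by metis
  have uniq: "Q x = q" if "q \<in> W" "\<And>w. w \<in> W \<Longrightarrow> inner (x - q) w = 0" for x q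
  proof -
    have d: "Q x - q \<in> W" using Q(1) that(1) W(1) by (simp add: subspace_diff)
    have "inner (Q x - q) (Q x - q) = inner (x - q) (Q x - q) - inner (x - Q x) (Q x - q)"
      by (simp add: inner_diff)
    also have "\<dots> = 0" using Q(2)[OF d] that(2)[OF d] by simp
    finally show ?thesis by simp
  qed
  define P where "P x = x - Q x" for x
  have linJ: "linear J" using J by (simp add: complex_structure_def)
  have Qadd: "Q (x + y) = Q x + Q y" for x y
  proof (rule uniq)
    fix w assume "w \<in> W"
    from Q(2)[OF this, of x] Q(2)[OF this, of y] show "inner (x + y - (Q x + Q y)) w = 0"
      by (simp add: inner_diff_left inner_add_left)
  qed (simp add: subspace_add[OF W(1)] Q(1))
  have Qscale: "Q (a *\<^sub>R x) = a *\<^sub>R Q x" for a x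
  proof (rule uniq)
    fix w assume "w \<in> W"
    from Q(2)[OF this, of x] show "inner (a *\<^sub>R x - a *\<^sub>R Q x) w = 0"
      by (simp add: inner_diff_left)
  qed (simp add: subspace_scale[OF W(1)] Q(1))
  have QJ: "Q (J x) = J (Q x)" for x
  proof (rule uniq)
    fix w assume "w \<in> W"
    have "inner (J x - J (Q x)) w = - inner (x - Q x) (J w)"
      by (simp add: linear_diff[OF linJ, symmetric] complex_structure_inner_left[OF J])
    with Q(2)[OF JW[OF \<open>w \<in> W\<close>]] show "inner (J x - J (Q x)) w = 0" by simp
  qed (simp add: JW Q(1))
  have QP: "Q (P x) = 0" for x
  proof (rule uniq)
    fix w assume "w \<in> W"
    from Q(2)[OF this, of x] show "inner (P x - 0) w = 0" by (simp add: P_def)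
  qed (rule subspace_0[OF W(1)])
  \<comment> \<open>This identity gives the norm bound when \<open>y = x\<close>, and
    self-adjointness because its right-hand side is symmetric.\<close>
  have self: "inner (P x) y = inner (P x) (P y)" for x y
    using Q(2)[OF Q(1)[of y], of x] by (simp add: P_def inner_diff_right)
  have "norm (P x) \<le> norm x" for x
  proof (cases "P x = 0")
    case False
    have "norm (P x) * norm (P x) = inner (P x) x"
      unfolding self[of x x] by (simp add: power2_norm_eq_inner[symmetric] power2_eq_square)
    also have "\<dots> \<le> norm (P x) * norm x" by (rule norm_cauchy_schwarz)
    finally show ?thesis using False by simp
  qed simp
  then have "bounded_linear P"
    by (intro bounded_linear_intro[where K = 1]) (auto simp: P_def Qadd Qscale algebra_simps)
  moreover have "P (P x) = P x" for x by (subst P_def) (simp add: QP)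
  moreover have "inner (P x) y = inner x (P y)" for x y
    using trans[OF self[of x y] trans[OF inner_commute self[of y x, symmetric]]] by (simp only: inner_commute)
  moreover have "P (J x) = J (P x)" for x by (simp add: P_def QJ linear_diff[OF linJ])
  ultimately have "orth_proj J P" by (simp add: orth_proj_def)
  moreover have "P x = 0 \<longleftrightarrow> x \<in> W" for x
    using uniq[of x x] Q(1)[of x] by (auto simp: P_def)
  ultimately show thesis by (rule that)
qed

text \<open>Complex orthogonality is split into the real equations \<open>eq\<close> and
  \<open>eqJ\<close>. Compactness is used for one projection only, the one onto the closed complex
  span of the values of \<open>b\<close>.\<close>

lemma lacunary_correlation_zero:
  fixes l :: "nat \<Rightarrow> nat" and \<alpha> :: "nat \<Rightarrow> 'b::{real_inner, complete_space}" and b :: "int \<Rightarrow> 'b"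
  assumes J: "complex_structure J"
    and c: "c > 1" and lac: "\<And>k. real (l (Suc k)) \<ge> c * real (l k)" and mono: "strict_mono l"
    and \<alpha>: "(\<lambda>t. (norm (\<alpha> t))\<^sup>2) summable_on UNIV"
    and b: "(\<lambda>i. (norm (b i))\<^sup>2) summable_on UNIV"
    and b0: "\<And>i. i < - M \<Longrightarrow> b i = 0"
    and eq: "\<And>n::nat. ((\<lambda>t. inner (\<alpha> t) (b (int (l t) - int n))) has_sum 0) UNIV"
    and eqJ: "\<And>n::nat. ((\<lambda>t. inner (\<alpha> t) (J (b (int (l t) - int n)))) has_sum 0) UNIV"
    and crc: "completely_rel_compact J \<alpha>"
    and total: "\<And>N y. (\<And>s. s \<ge> N \<Longrightarrow> inner (\<alpha> s) y = 0 \<and> inner (\<alpha> s) (J y) = 0) \<Longrightarrow> y = 0"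
  shows "b j = 0"
proof -
  \<comment> \<open>Closing the values of \<open>b\<close> under \<open>J\<close> makes their
    orthogonal complement \<open>W\<close> invariant under \<open>J\<close>, as the kernel of a
    complex projection must be.\<close>
  define B where "B = range b \<union> range (\<lambda>i. J (b i))"
  define W where "W = {w. \<forall>v\<in>B. inner w v = 0}"
  have "subspace W" by (auto simp: subspace_def W_def inner_add_left)
  moreover have "W = (\<Inter>v\<in>B. {w. inner w v = 0})" by (auto simp: W_def)
  then have "closed W" by (auto intro!: closed_INT closed_Collect_eq continuous_intros)
  moreover have "J w \<in> W" if "w \<in> W" for w
  proof -
    have "inner (J w) (b i) = 0" for i
      using that by (simp add: W_def B_def complex_structure_inner_left[OF J])
    moreover have "inner (J w) (J (b i)) = 0" for i
      using that J by (simp add: W_def B_def complex_structure_def)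
    ultimately show ?thesis by (auto simp: W_def B_def)
  qed
  ultimately obtain P where P: "orth_proj J P" and P0: "\<And>x. P x = 0 \<longleftrightarrow> x \<in> W"
    using orth_proj_with_kernel[OF J] by blast
  have lin: "bounded_linear P" and idem: "\<And>x. P (P x) = P x"
    and adj: "\<And>x y. inner (P x) y = inner x (P y)"
    using P by (auto simp: orth_proj_def)
  \<comment> \<open>The vector \<open>v - P v\<close> lies in the kernel \<open>W\<close>, so it is
    orthogonal to \<open>v\<close>; it is also orthogonal to \<open>P v\<close>, hence to
    itself.\<close>
  have PB: "P v = v" if "v \<in> B" for v
  proof -
    have k: "P (v - P v) = 0" by (simp add: linear_diff[OF bounded_linear.linear[OF lin]] idem)
    then have "inner (v - P v) v = 0" using P0 that by (auto simp: W_def)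
    moreover have "inner (v - P v) (P v) = 0" using k adj[of "v - P v" v] by simp
    ultimately have "inner (v - P v) (v - P v) = 0" by (simp only: inner_diff_right)
    then show ?thesis by simp
  qed
  define x where "x s = P (\<alpha> s)" for s
  have inner_x: "inner (x s) v = inner (\<alpha> s) v" if "v \<in> B" for s v
    using PB[OF that] by (simp add: x_def adj)
  show ?thesis
  \<comment> \<open>If \<open>x\<close> vanishes eventually, \<open>total\<close> applies at once.
    Otherwise all tails of \<open>h\<close> are positive, and the series of terms over tails is
    shown to converge, which is impossible.\<close>
  proof (cases "\<exists>N. \<forall>s\<ge>N. x s = 0")
    case True
    then obtain N where N: "\<And>s. s \<ge> N \<Longrightarrow> x s = 0" by blast
    show ?thesis
    proof (rule total)
      fix s assume "s \<ge> N"
      then show "inner (\<alpha> s) (b j) = 0 \<and> inner (\<alpha> s) (J (b j)) = 0"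
        using inner_x[of "b j" s] inner_x[of "J (b j)" s] N by (simp add: B_def)
    qed
  next
    case False
    define h where "h s = (norm (x s))\<^sup>2" for s
    have h: "h summable_on UNIV"
    proof -
      obtain C where C: "\<And>y. norm (P y) \<le> norm y * C"
        using bounded_linear.bounded[OF lin] by blast
      have "norm (h s) \<le> C\<^sup>2 * (norm (\<alpha> s))\<^sup>2" for s
        using power_mono[OF C norm_ge_zero, of "\<alpha> s" 2]
        by (simp add: h_def x_def power_mult_distrib mult.commute)
      moreover have "summable (\<lambda>s. C\<^sup>2 * (norm (\<alpha> s))\<^sup>2)"
        using summable_on_imp_summable[OF \<alpha>] by (rule summable_mult)
      ultimately have "summable h" by (intro summable_comparison_test'[of _ 0 h])
      then show ?thesis by (rule summable_nonneg_imp_summable_on) (simp add: h_def)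
    qed
    have pos: "infsum h {s..} > 0" for s
    proof -
      obtain t where t: "t \<ge> s" "x t \<noteq> 0" using False by blast
      have "0 < sum h {t}" using t by (simp add: h_def)
      also have "\<dots> \<le> infsum h {s..}"
        using t by (intro finite_sum_le_infsum summable_on_subset[OF h]) (auto simp: h_def)
      finally show ?thesis .
    qed
    have quot: "summable (\<lambda>s. (inner (x s) v)\<^sup>2 / infsum h {Suc s..})" if v: "v \<in> B" for v
    proof -
      consider i where "v = b i" | i where "v = J (b i)" using v by (auto simp: B_def)
      then show ?thesis
      proof cases
        case 1
        show ?thesis unfolding 1 h_def
        proof (rule lacunary_coefficient_quotient_summable[OF c lac mono _ b b0])
          show "((\<lambda>t. inner (x t) (b (int (l t) - int n))) has_sum 0) UNIV" for n
            using eq[of n] by (simp add: inner_x B_def)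
        qed (use h pos in \<open>simp_all add: h_def[abs_def]\<close>)
      next
        case 2
        \<comment> \<open>The isometry \<open>J\<close> fixes 0, so \<open>J (b i)\<close> satisfies
          the same hypotheses as \<open>b i\<close>, with \<open>eqJ\<close> in the role of
          \<open>eq\<close>.\<close>
        have lin0: "J 0 = 0" using J by (simp add: complex_structure_def linear_0)
        show ?thesis unfolding 2 h_def
        proof (rule lacunary_coefficient_quotient_summable[OF c lac mono])
          show "((\<lambda>t. inner (x t) (J (b (int (l t) - int n)))) has_sum 0) UNIV" for n
            using eqJ[of n] by (simp add: inner_x B_def)
          show "J (b i) = 0" if "i < - M" for i using b0[OF that] lin0 by simp
        qed (use h pos b in \<open>simp_all add: h_def[abs_def] complex_structure_norm[OF J]\<close>)
      qed
    qed
    define K where "K = closure {P (\<alpha> k) /\<^sub>R norm (P (\<alpha> k)) | k. P (\<alpha> k) \<noteq> 0}"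
    have K: "compact K" using crc P unfolding completely_rel_compact_def K_def by blast
    have u_in_K: "x s /\<^sub>R norm (x s) \<in> K" if "x s \<noteq> 0" for s
      unfolding K_def x_def using that by (intro subsetD[OF closure_subset]) (auto simp: x_def)
    then have Kne: "K \<noteq> {}" using False by blast
    have "continuous_on UNIV P" using lin by (simp add: linear_continuous_on)
    then have "closed {u. P u = u \<and> norm u = 1}"
      by (intro closed_Collect_conj closed_Collect_eq continuous_intros)
    then have K_sub: "K \<subseteq> {u. P u = u \<and> norm u = 1}"
      unfolding K_def
      by (intro closure_minimal)
        (auto simp: linear_scale[OF bounded_linear.linear[OF lin]] idem)
    \<comment> \<open>Points of \<open>K\<close> are unit vectors in the range of \<open>P\<close>,
      hence outside \<open>W\<close>, so each pairs nontrivially with some \<open>v \<in> B\<close>.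
      Compactness then leaves finitely many such \<open>v\<close>.\<close>
    have "K \<subseteq> (\<Union>v\<in>B. {u. inner u v \<noteq> 0})"
    proof
      fix u assume "u \<in> K"
      then have "P u \<noteq> 0" using K_sub by force
      then show "u \<in> (\<Union>v\<in>B. {u. inner u v \<noteq> 0})" using P0 by (auto simp: W_def)
    qed
    moreover have "open {u. inner u v \<noteq> 0}" for v :: 'b
      by (intro open_Collect_neq continuous_intros)
    ultimately obtain I where I: "I \<subseteq> B" "finite I" "K \<subseteq> (\<Union>v\<in>I. {u. inner u v \<noteq> 0})"
      using compactE_image[OF K, of B "\<lambda>v. {u. inner u v \<noteq> 0}"] by metis
    have "continuous_on K (\<lambda>u. \<Sum>v\<in>I. (inner u v)\<^sup>2)" by (intro continuous_intros)
    then obtain u0 where u0: "u0 \<in> K" "\<forall>u\<in>K. (\<Sum>v\<in>I. (inner u0 v)\<^sup>2) \<le> (\<Sum>v\<in>I. (inner u v)\<^sup>2)"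
      using continuous_attains_inf[OF K Kne] by blast
    define \<delta> where "\<delta> = (\<Sum>v\<in>I. (inner u0 v)\<^sup>2)"
    have "\<delta> > 0"
    proof -
      obtain v where "v \<in> I" "inner u0 v \<noteq> 0" using u0(1) I(3) by blast
      then show ?thesis unfolding \<delta>_def using I(2) by (intro sum_pos2[of I v]) auto
    qed
    \<comment> \<open>Both sides are homogeneous of degree two in \<open>x s\<close>, and
      \<open>\<delta>\<close> is the minimum over \<open>K\<close>, which contains the normalised
      vectors.\<close>
    have lower: "\<delta> * h s \<le> (\<Sum>v\<in>I. (inner (x s) v)\<^sup>2)" for s
    proof (cases "x s = 0")
      case True
      then show ?thesis by (simp add: h_def)
    next
      case False
      have "\<delta> \<le> (\<Sum>v\<in>I. (inner (x s /\<^sub>R norm (x s)) v)\<^sup>2)"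
        unfolding \<delta>_def using u0(2) u_in_K[OF False] by blast
      also have "\<dots> = (\<Sum>v\<in>I. (inner (x s) v)\<^sup>2) / h s"
        by (simp add: h_def power_mult_distrib sum_divide_distrib divide_simps)
      finally show ?thesis using False by (simp add: h_def pos_le_divide_eq)
    qed
    have "summable (\<lambda>s. \<Sum>v\<in>I. (inner (x s) v)\<^sup>2 / infsum h {Suc s..})"
      using I(1) quot by (intro summable_sum) auto
    then have "summable (\<lambda>s. (\<Sum>v\<in>I. (inner (x s) v)\<^sup>2 / infsum h {Suc s..}) / \<delta>)"
      by (rule summable_divide)
    moreover have "norm (h s / infsum h {Suc s..}) \<le> (\<Sum>v\<in>I. (inner (x s) v)\<^sup>2 / infsum h {Suc s..}) / \<delta>" for s
    proof -
      have "h s \<le> (\<Sum>v\<in>I. (inner (x s) v)\<^sup>2) / \<delta>"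
        using lower[of s] \<open>\<delta> > 0\<close> by (simp add: pos_le_divide_eq mult.commute)
      then have "h s / infsum h {Suc s..} \<le> (\<Sum>v\<in>I. (inner (x s) v)\<^sup>2) / \<delta> / infsum h {Suc s..}"
        using pos[of "Suc s"] by (intro divide_right_mono) auto
      moreover have "0 \<le> h s / infsum h {Suc s..}"
        using pos[of "Suc s"] by (simp add: h_def)
      ultimately show ?thesis by (simp add: sum_divide_distrib[symmetric] mult.commute)
    qed
    ultimately have "summable (\<lambda>s. h s / infsum h {Suc s..})"
      by (intro summable_comparison_test'[of _ 0 "\<lambda>s. h s / infsum h {Suc s..}"])
    with not_summable_divide_tail[OF h _ pos] show ?thesis by (simp add: h_def)
  qed
qed

section \<open>Duality for spans and cyclicity\<close>

text \<open>This reduces complex spans to real ones, with \<open>v i\<close> in the role of the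
  imaginary unit times \<open>u i\<close>. Indexed families serve both a set of vectors and an
  orbit, whose members may repeat.\<close>

lemma complex_combinations_eq_span:
  fixes u v :: "'i \<Rightarrow> 'b::real_vector"
  shows "{y. \<exists>A c. finite A \<and> A \<subseteq> I \<and> y = (\<Sum>i\<in>A. Re (c i) *\<^sub>R u i + Im (c i) *\<^sub>R v i)}
    = span (u ` I \<union> v ` I)" (is "?C = _")
proof (rule antisym)
  show "?C \<subseteq> span (u ` I \<union> v ` I)"
    by (auto intro!: span_sum span_add span_scale intro: span_base)
  have memI: "(\<Sum>i\<in>A. Re (c i) *\<^sub>R u i + Im (c i) *\<^sub>R v i) \<in> ?C" if "finite A" "A \<subseteq> I" for A c
    using that by blast
  show "span (u ` I \<union> v ` I) \<subseteq> ?C"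
  proof (rule span_minimal)
    have "u i \<in> ?C" "v i \<in> ?C" if "i \<in> I" for i
      using memI[of "{i}" "\<lambda>_. 1"] memI[of "{i}" "\<lambda>_. \<i>"] that by simp_all
    then show "u ` I \<union> v ` I \<subseteq> ?C" by blast
    show "subspace ?C"
    proof (rule subspaceI)
      show "0 \<in> ?C" using memI[of "{}"] by simp
    next
      fix x y assume "x \<in> ?C" "y \<in> ?C"
      then obtain A c A' c' where A: "finite A" "A \<subseteq> I" "finite A'" "A' \<subseteq> I"
        and x: "x = (\<Sum>i\<in>A. Re (c i) *\<^sub>R u i + Im (c i) *\<^sub>R v i)"
        and y: "y = (\<Sum>i\<in>A'. Re (c' i) *\<^sub>R u i + Im (c' i) *\<^sub>R v i)" by blast
      \<comment> \<open>Both coefficient families are extended by zero to the common index set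
        \<open>A \<union> A'\<close>.\<close>
      define d where "d i = (if i \<in> A then c i else 0)" for i
      define d' where "d' i = (if i \<in> A' then c' i else 0)" for i
      have "x = (\<Sum>i\<in>A \<union> A'. Re (d i) *\<^sub>R u i + Im (d i) *\<^sub>R v i)"
        unfolding x using A by (intro sum.mono_neutral_cong_left) (auto simp: d_def)
      moreover have "y = (\<Sum>i\<in>A \<union> A'. Re (d' i) *\<^sub>R u i + Im (d' i) *\<^sub>R v i)"
        unfolding y using A by (intro sum.mono_neutral_cong_left) (auto simp: d'_def)
      ultimately have "x + y = (\<Sum>i\<in>A \<union> A'. Re (d i + d' i) *\<^sub>R u i + Im (d i + d' i) *\<^sub>R v i)"
        by (simp add: sum.distrib algebra_simps)
      then show "x + y \<in> ?C" using memI[of "A \<union> A'" "\<lambda>i. d i + d' i"] A by simp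
    next
      fix a x assume "x \<in> ?C"
      then obtain A c where A: "finite A" "A \<subseteq> I"
        and x: "x = (\<Sum>i\<in>A. Re (c i) *\<^sub>R u i + Im (c i) *\<^sub>R v i)" by blast
      have "a *\<^sub>R x = (\<Sum>i\<in>A. Re (of_real a * c i) *\<^sub>R u i + Im (of_real a * c i) *\<^sub>R v i)"
        unfolding x by (simp add: scaleR_sum_right algebra_simps)
      then show "a *\<^sub>R x \<in> ?C" using memI[OF A, of "\<lambda>i. of_real a * c i"] by simp
    qed
  qed
qed

lemma cspan_eq_span: "cspan J S = span (S \<union> J ` S)"
  using complex_combinations_eq_span[of S "\<lambda>x. x" J] by (simp add: cspan_def csmul_def)

lemma dense_span_iff_orthogonal_trivial:
  fixes X :: "'b::{real_inner, complete_space} set"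
  shows "closure (span X) = UNIV \<longleftrightarrow> (\<forall>y. (\<forall>w\<in>X. inner w y = 0) \<longrightarrow> y = 0)"
proof -
  have "(\<forall>w\<in>span X. inner w y = 0) \<longleftrightarrow> (\<forall>w\<in>X. inner w y = 0)" for y
  proof
    assume X: "\<forall>w\<in>X. inner w y = 0"
    have "subspace {w. inner w y = 0}" by (auto simp: subspace_def inner_add_left)
    then have "span X \<subseteq> {w. inner w y = 0}" using X by (intro span_minimal) auto
    then show "\<forall>w\<in>span X. inner w y = 0" by blast
  qed (auto intro: span_base)
  then show ?thesis by (simp add: dense_subspace_iff_orthogonal_trivial[OF subspace_span])
qed

lemma l2_coeff_sum: "l2_coeff (\<Sum>j\<in>A. f j) k = (\<Sum>j\<in>A. l2_coeff (f j) k)"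
  by (induction A rule: infinite_finite_induct) (simp_all add: zero_l2.rep_eq plus_l2.rep_eq)

text \<open>Complex combinations of the orbit form the real span of the shifts and their images
  under \<open>J\<close>, so the real density criterion applies. Moving \<open>J\<close> over to
  \<open>G\<close> only changes a sign.\<close>

lemma cyclic_bshift_iff_orthogonal_trivial:
  fixes F :: "nat \<Rightarrow> 'b::{real_inner, complete_space}"
  assumes J: "complex_structure J" and F: "H2 F"
  shows "cyclic_bshift J F \<longleftrightarrow>
    (\<forall>G. H2 G \<longrightarrow> (\<forall>n. (\<Sum>k. inner (F (k + n)) (G k)) = 0 \<and> (\<Sum>k. inner (F (k + n)) (J (G k))) = 0)
      \<longrightarrow> G = (\<lambda>k. 0))"
proof -
  define u where "u j = l2_of (bshift j F)" for j
  define v where "v j = l2_of (\<lambda>k. J (bshift j F k))" for j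
  have u: "l2_coeff (u j) = bshift j F" for j
    unfolding u_def by (rule l2_coeff_of[OF H2_bshift[OF F]])
  have v: "l2_coeff (v j) = (\<lambda>k. J (bshift j F k))" for j
    unfolding v_def using H2_bshift[OF F, of j]
    by (intro l2_coeff_of) (simp add: H2_def complex_structure_norm[OF J])
  define T where "T n c = (\<Sum>j<n. Re (c j) *\<^sub>R u j + Im (c j) *\<^sub>R v j)" for n and c :: "nat \<Rightarrow> complex"
  have T: "l2_coeff (T n c) = (\<lambda>k. \<Sum>j<n. csmul J (c j) (bshift j F k))" for n c
    by (simp add: T_def l2_coeff_sum plus_l2.rep_eq scaleR_l2.rep_eq u v csmul_def fun_eq_iff)
  have range_T: "{y. \<exists>n c. y = T n c} = span (range u \<union> range v)"
    unfolding complex_combinations_eq_span[symmetric]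
  proof (intro Collect_cong iffI)
    fix y assume "\<exists>n c. y = T n c"
    then show "\<exists>A c. finite A \<and> A \<subseteq> UNIV \<and> y = (\<Sum>i\<in>A. Re (c i) *\<^sub>R u i + Im (c i) *\<^sub>R v i)"
      unfolding T_def by blast
  next
    fix y assume "\<exists>A c. finite A \<and> A \<subseteq> UNIV \<and> y = (\<Sum>i\<in>A. Re (c i) *\<^sub>R u i + Im (c i) *\<^sub>R v i)"
    then obtain A c where A: "finite A" and y: "y = (\<Sum>i\<in>A. Re (c i) *\<^sub>R u i + Im (c i) *\<^sub>R v i)"
      by blast
    \<comment> \<open>Cyclicity uses sums over initial segments, so a finite index set is padded
      with zero coefficients.\<close>
    obtain n where n: "A \<subseteq> {..<n}" using finite_nat_bounded[OF A] by blast
    have "y = T n (\<lambda>i. if i \<in> A then c i else 0)"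
      unfolding y T_def using n by (intro sum.mono_neutral_cong_left) auto
    then show "\<exists>n c. y = T n c" by blast
  qed
  have dist_T: "dist (T n c) (l2_of G) = H2_norm (\<lambda>k. G k - (\<Sum>j<n. csmul J (c j) (bshift j F k)))"
    if "H2 G" for n c G
    by (simp add: dist_norm norm_l2_eq_H2_norm minus_l2.rep_eq T l2_coeff_of[OF that]
        H2_norm_def norm_minus_commute)
  have "cyclic_bshift J F \<longleftrightarrow> closure (span (range u \<union> range v)) = UNIV"
  proof
    assume cyc: "cyclic_bshift J F"
    have "g \<in> closure {y. \<exists>n c. y = T n c}" for g
      unfolding closure_approachable
    proof (intro allI impI)
      fix e :: real assume "e > 0"
      then obtain n c where "H2_norm (\<lambda>k. l2_coeff g k - (\<Sum>j<n. csmul J (c j) (bshift j F k))) < e"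
        using cyc H2_l2_coeff[of g] unfolding cyclic_bshift_def by blast
      then have "dist (T n c) g < e"
        using dist_T[OF H2_l2_coeff, of n c g] by (simp add: l2_coeff_inverse)
      then show "\<exists>y\<in>{y. \<exists>n c. y = T n c}. dist y g < e" by blast
    qed
    then show "closure (span (range u \<union> range v)) = UNIV" by (auto simp: range_T)
  next
    assume dense: "closure (span (range u \<union> range v)) = UNIV"
    show "cyclic_bshift J F"
      unfolding cyclic_bshift_def
    proof (intro allI impI)
      fix G :: "nat \<Rightarrow> 'b" and e :: real assume G: "H2 G" "e > 0"
      have "l2_of G \<in> closure {y. \<exists>n c. y = T n c}" using dense by (simp add: range_T)
      then obtain n c where "dist (T n c) (l2_of G) < e"
        using G(2) unfolding closure_approachable by blast
      then show "\<exists>n c. H2_norm (\<lambda>k. G k - (\<Sum>j<n. csmul J (c j) (bshift j F k))) < e"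
        using dist_T[OF G(1)] by auto
    qed
  qed
  also have "\<dots> \<longleftrightarrow> (\<forall>g. (\<forall>n. inner (u n) g = 0 \<and> inner (v n) g = 0) \<longrightarrow> g = 0)"
    unfolding dense_span_iff_orthogonal_trivial by (intro all_cong1) blast
  also have "\<dots> \<longleftrightarrow> (\<forall>g. (\<forall>n. (\<Sum>k. inner (F (k + n)) (l2_coeff g k)) = 0 \<and>
      (\<Sum>k. inner (F (k + n)) (J (l2_coeff g k))) = 0) \<longrightarrow> g = 0)"
  proof -
    have "inner (u n) g = (\<Sum>k. inner (F (k + n)) (l2_coeff g k))" for n g
      by (simp add: inner_l2.rep_eq u bshift_def)
    moreover have "inner (v n) g = - (\<Sum>k. inner (F (k + n)) (J (l2_coeff g k)))" for n g
    proof -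
      have "H2 (\<lambda>k. J (l2_coeff g k))"
        using H2_l2_coeff[of g] by (simp add: H2_def complex_structure_norm[OF J])
      from summable_norm_cancel[OF H2_summable_inner[OF H2_bshift[OF F, of n] this]]
      show ?thesis
        by (simp add: inner_l2.rep_eq v bshift_def complex_structure_inner_left[OF J] suminf_minus)
    qed
    ultimately show ?thesis by simp
  qed
  also have "\<dots> \<longleftrightarrow> (\<forall>G. H2 G \<longrightarrow> (\<forall>n. (\<Sum>k. inner (F (k + n)) (G k)) = 0 \<and>
      (\<Sum>k. inner (F (k + n)) (J (G k))) = 0) \<longrightarrow> G = (\<lambda>k. 0))" (is "(\<forall>g. ?A (l2_coeff g) \<longrightarrow> g = 0) \<longleftrightarrow> ?R")
  proof
    assume L: "\<forall>g. ?A (l2_coeff g) \<longrightarrow> g = 0"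
    show ?R
    proof (intro allI impI)
      fix G assume G: "H2 G" "?A G"
      then have "l2_of G = 0" using L[rule_format, of "l2_of G"] by (simp add: l2_coeff_of)
      then have "l2_coeff (l2_of G) = l2_coeff 0" by simp
      then show "G = (\<lambda>k. 0)" by (simp add: l2_coeff_of G zero_l2.rep_eq)
    qed
  next
    assume ?R
    then have "?A (l2_coeff g) \<longrightarrow> l2_coeff g = l2_coeff 0" for g
      using H2_l2_coeff[of g] by (simp add: zero_l2.rep_eq)
    then show "\<forall>g. ?A (l2_coeff g) \<longrightarrow> g = 0" by (simp only: l2_coeff_inject) simp
  qed
  finally show ?thesis .
qed

text \<open>The sequence of the theorem, extended to all integer indices.\<close>

definition aligned_coef :: "('d \<Rightarrow> int) \<Rightarrow> (nat \<Rightarrow> 'a::zero^'d) \<Rightarrow> int \<Rightarrow> 'a^'d" where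
  "aligned_coef m G j = (\<chi> i. coef G i (j + m i))"

section \<open>Correlations of coefficient sequences as sums over the integers\<close>

lemma H2_component:
  assumes "H2 (G :: nat \<Rightarrow> 'a::real_normed_vector^'d)"
  shows "H2 (\<lambda>k. G k $ i)"
  unfolding H2_def
proof (rule summable_comparison_test'[of _ 0])
  show "summable (\<lambda>k. (norm (G k))\<^sup>2)" using assms by (simp add: H2_def)
  show "norm ((norm (G k $ i))\<^sup>2) \<le> (norm (G k))\<^sup>2" for k
    using power_mono[OF Finite_Cartesian_Product.norm_nth_le norm_ge_zero, of "G k" i 2] by simp
qed

text \<open>The translated naturals contain the support of \<open>\<phi>\<close>, so the starting
  point \<open>a\<close> can be changed without changing the sum.\<close>

lemma has_sum_nat_int_shift:
  fixes \<phi> :: "int \<Rightarrow> 'c::{comm_monoid_add, topological_space}"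
  assumes "\<And>t. t < a \<Longrightarrow> \<phi> t = 0"
  shows "((\<lambda>k::nat. \<phi> (int k + a)) has_sum S) UNIV \<longleftrightarrow> (\<phi> has_sum S) UNIV"
proof -
  have inj: "inj (\<lambda>k::nat. int k + a)" by (auto intro: injI)
  have "t \<in> range (\<lambda>k::nat. int k + a)" if "t \<ge> a" for t
    using that by (intro image_eqI[of _ _ "nat (t - a)"]) auto
  then have "\<phi> t = 0" if "t \<notin> range (\<lambda>k::nat. int k + a)" for t
    using assms that not_le by blast
  then have "(\<phi> has_sum S) UNIV \<longleftrightarrow> (\<phi> has_sum S) (range (\<lambda>k::nat. int k + a))"
    by (intro has_sum_cong_neutral) auto
  then show ?thesis using has_sum_reindex[OF inj, of \<phi> S] by (simp add: o_def)
qed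

lemma has_sum_sum_finite:
  fixes f :: "'i \<Rightarrow> 'k \<Rightarrow> 'c::topological_comm_monoid_add"
  assumes "\<And>i. i \<in> I \<Longrightarrow> (f i has_sum s i) A"
  shows "((\<lambda>k. \<Sum>i\<in>I. f i k) has_sum (\<Sum>i\<in>I. s i)) A"
  using assms by (induction I rule: infinite_finite_induct) (auto intro: has_sum_add)

text \<open>In each coordinate the correlation is a sum over all integers and so invariant under
  translation. Every coordinate can therefore be shifted by its own \<open>m i\<close> before the
  coordinates are added.\<close>

lemma has_sum_aligned_coef:
  fixes F G :: "nat \<Rightarrow> 'a::real_inner^'d"
  assumes F: "H2 F" and G: "H2 G" and F0: "\<And>i t. t < m i \<Longrightarrow> coef F i t = 0"
  shows "((\<lambda>k. inner (aligned_coef m F (int k)) (aligned_coef m G (int k - int n)))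
    has_sum (\<Sum>k. inner (F (k + n)) (G k))) UNIV"
proof -
  define \<phi> where "\<phi> i t = inner (coef F i (t + int n)) (coef G i t)" for i t
  define s where "s i = (\<Sum>k. inner (F (k + n) $ i) (G k $ i))" for i
  have s: "((\<lambda>k::nat. \<phi> i (int k)) has_sum s i) UNIV" for i
  proof -
    have "summable (\<lambda>k. norm (inner (F (k + n) $ i) (G k $ i)))"
      using H2_summable_inner[OF H2_component[OF H2_bshift[OF F, of n], of i] H2_component[OF G, of i]]
      by (simp add: bshift_def)
    moreover from summable_norm_cancel[OF this] have "(\<lambda>k. inner (F (k + n) $ i) (G k $ i)) sums s i"
      unfolding s_def by (rule summable_sums)
    ultimately have "((\<lambda>k. inner (F (k + n) $ i) (G k $ i)) has_sum s i) UNIV"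
      by (rule norm_summable_imp_has_sum)
    then show ?thesis by (simp add: \<phi>_def coef_def nat_add_distrib nat_int_add)
  qed
  have "(\<phi> i has_sum s i) UNIV" for i
    using s[of i] has_sum_nat_int_shift[of 0 "\<phi> i" "s i"] by (simp add: \<phi>_def coef_def)
  \<comment> \<open>Below \<open>m i - n\<close> the first factor has its index below
    \<open>m i\<close>, where \<open>F0\<close> makes it zero.\<close>
  then have "((\<lambda>k::nat. \<phi> i (int k + (m i - int n))) has_sum s i) UNIV" for i
    by (subst has_sum_nat_int_shift) (auto simp: \<phi>_def F0)
  then have "((\<lambda>k::nat. \<Sum>i\<in>UNIV. \<phi> i (int k + (m i - int n))) has_sum (\<Sum>i\<in>UNIV. s i)) UNIV"
    by (intro has_sum_sum_finite)
  moreover have "(\<Sum>i\<in>UNIV. \<phi> i (int k + (m i - int n)))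
      = inner (aligned_coef m F (int k)) (aligned_coef m G (int k - int n))" for k
    by (simp add: \<phi>_def aligned_coef_def inner_vec_def algebra_simps)
  moreover have "(\<Sum>i\<in>UNIV. s i) = (\<Sum>k. inner (F (k + n)) (G k))"
  proof -
    have "((\<lambda>k::nat. \<Sum>i\<in>UNIV. \<phi> i (int k)) has_sum (\<Sum>i\<in>UNIV. s i)) UNIV"
      using s by (intro has_sum_sum_finite)
    moreover have "(\<Sum>i\<in>UNIV. \<phi> i (int k)) = inner (F (k + n)) (G k)" for k
      by (simp add: \<phi>_def coef_def nat_int_add inner_vec_def)
    ultimately show ?thesis using sums_unique[OF has_sum_imp_sums] by simp
  qed
  ultimately show ?thesis by simp
qed

lemma summable_on_aligned_coef:
  fixes G :: "nat \<Rightarrow> 'a::real_inner^'d"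
  assumes "H2 G"
  shows "(\<lambda>j. (norm (aligned_coef m G j))\<^sup>2) summable_on UNIV"
proof -
  have "(\<lambda>j. (norm (coef G i (j + m i)))\<^sup>2) summable_on UNIV" for i
  proof -
    have "(\<lambda>k. (norm (G k $ i))\<^sup>2) summable_on UNIV"
      using H2_component[OF assms, of i] unfolding H2_def by (rule summable_nonneg_imp_summable_on) simp
    then have "(\<lambda>k. (norm (coef G i (int k)))\<^sup>2) summable_on UNIV" by (simp add: coef_def)
    then have "(\<lambda>j. (norm (coef G i j))\<^sup>2) summable_on UNIV"
      using has_sum_nat_int_shift[of 0 "\<lambda>j. (norm (coef G i j))\<^sup>2"]
      by (simp add: summable_on_def coef_def)
    moreover have "bij (\<lambda>j. j + m i)" by (rule bij_plus_right)
    ultimately show ?thesis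
      using summable_on_reindex_bij_betw[of "\<lambda>j. j + m i" UNIV UNIV "\<lambda>j. (norm (coef G i j))\<^sup>2"] by simp
  qed
  then have "(\<lambda>j. \<Sum>i\<in>UNIV. (norm (coef G i (j + m i)))\<^sup>2) summable_on UNIV"
    by (rule has_sum_imp_summable[OF has_sum_sum_finite[OF has_sum_infsum]])
  then show ?thesis
    by (simp add: aligned_coef_def norm_vec_def L2_set_def sum_nonneg)
qed

section \<open>Cyclicity against density of the spans of all tails\<close>

theorem mainTheorem13:
  fixes J :: "'a::{real_inner, complete_space} \<Rightarrow> 'a"
    and L :: "nat set"
    and m :: "'d::finite \<Rightarrow> int"
    and F :: "nat \<Rightarrow> 'a^'d"
  assumes "complex_structure J"
    and "separable_space (euclidean :: 'a topology)"
    and "lacunary L"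
    and "H2 F"
    and "\<And>i. spectrum_of F i \<subseteq> (\<lambda>l. int l + m i) ` L"
    and "completely_rel_compact (Jvec J) (\<lambda>k. \<chi> i. coef F i (int k + m i))"
  shows "cyclic_bshift (Jvec J) F \<longleftrightarrow>
    (\<forall>N. closure (cspan (Jvec J) {(\<chi> i. coef F i (int k + m i)) | k. k \<ge> N}) = UNIV)"
proof -
  let ?J = "Jvec J :: 'a^'d \<Rightarrow> 'a^'d"
  define a where "a = aligned_coef m F"
  have a_eq: "(\<chi> i. coef F i (int k + m i)) = a (int k)" for k by (simp add: a_def aligned_coef_def)
  have J: "complex_structure ?J" by (rule complex_structure_Jvec[OF assms(1)])
  have J0: "J 0 = 0" using assms(1) by (simp add: complex_structure_def linear_0)
  have F_off: "t - m i \<in> int ` L" if "coef F i t \<noteq> 0" for i t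
    using that assms(5)[of i] by (auto simp: spectrum_of_def)
  \<comment> \<open>Elements of \<open>L\<close> are nonnegative, so the \<open>i\<close>-th
    spectrum starts no earlier than \<open>m i\<close>; hence the correlations run over natural
    \<open>k\<close> only.\<close>
  have F0: "coef F i t = 0" if "t < m i" for i t
  proof (rule ccontr)
    assume "coef F i t \<noteq> 0"
    with F_off[of i t] that show False by auto
  qed
  have H2J: "H2 (\<lambda>k. ?J (G k))" if "H2 G" for G
    using that by (simp add: H2_def complex_structure_norm[OF J])
  have aligned_J: "aligned_coef m (\<lambda>k. ?J (G k)) j = ?J (aligned_coef m G j)" for G j
    by (simp add: aligned_coef_def Jvec_def vec_eq_iff coef_def J0)
  have pair: "((\<lambda>k. inner (a (int k)) (aligned_coef m G (int k - int n)))
      has_sum (\<Sum>k. inner (F (k + n)) (G k))) UNIV"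
    "((\<lambda>k. inner (a (int k)) (?J (aligned_coef m G (int k - int n))))
      has_sum (\<Sum>k. inner (F (k + n)) (?J (G k)))) UNIV" if "H2 G" for G n
    using has_sum_aligned_coef[where m = m and n = n, OF assms(4) that F0]
      has_sum_aligned_coef[where m = m and n = n, OF assms(4) H2J[OF that] F0]
    by (simp_all add: a_def aligned_J)
  \<comment> \<open>A common bound for all \<open>\<bar>m i\<bar>\<close>: a shift by
    \<open>M\<close> makes every index nonnegative, and aligned coefficients vanish below
    \<open>- M\<close>.\<close>
  define M where "M = (\<Sum>i\<in>UNIV. \<bar>m i\<bar>)"
  have M: "\<bar>m i\<bar> \<le> M" for i unfolding M_def by (rule member_le_sum) auto
  have cyc: "cyclic_bshift ?J F \<longleftrightarrow> (\<forall>G. H2 G \<longrightarrow> (\<forall>n. (\<Sum>k. inner (F (k + n)) (G k)) = 0 \<and>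
      (\<Sum>k. inner (F (k + n)) (?J (G k))) = 0) \<longrightarrow> G = (\<lambda>k. 0))"
    by (rule cyclic_bshift_iff_orthogonal_trivial[OF J assms(4)])
  have spn: "closure (cspan ?J {(\<chi> i. coef F i (int k + m i)) | k. k \<ge> N}) = UNIV \<longleftrightarrow>
      (\<forall>y. (\<forall>k\<ge>N. inner (a (int k)) y = 0 \<and> inner (a (int k)) (?J y) = 0) \<longrightarrow> y = 0)" for N
  proof -
    have "(\<forall>w\<in>{a (int k) | k. k \<ge> N} \<union> ?J ` {a (int k) | k. k \<ge> N}. inner w y = 0) \<longleftrightarrow>
        (\<forall>k\<ge>N. inner (a (int k)) y = 0 \<and> inner (?J (a (int k))) y = 0)" for y
      by blast
    then show ?thesis
      unfolding cspan_eq_span dense_span_iff_orthogonal_trivial a_eq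
      by (simp add: complex_structure_inner_left[OF J])
  qed
  show ?thesis
  proof
    assume "cyclic_bshift ?J F"
    note cyc_F = cyc[THEN iffD1, OF this, rule_format]
    have "y = 0" if y: "\<forall>k\<ge>N. inner (a (int k)) y = 0 \<and> inner (a (int k)) (?J y) = 0" for N y
    proof -
      \<comment> \<open>Adding \<open>M\<close> keeps the positions \<open>R + m i\<close>
        nonnegative. The only nonzero aligned coefficient of \<open>G\<close> then sits at
        \<open>R \<ge> N\<close>, so it meets \<open>a k\<close> only for
        \<open>k = R + n \<ge> N\<close>.\<close>
      define R where "R = int N + M"
      have R: "R + m i \<ge> 0" for i using M[of i] by (simp add: R_def)
      define G where "G k = (\<chi> i. if int k = R + m i then y $ i else 0)" for k
      have "coef G i (j + m i) = (if j = R then y $ i else 0)" for i j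
        using R[of i] by (auto simp: coef_def G_def)
      then have bG: "aligned_coef m G j = (if j = R then y else 0)" for j
        by (simp add: aligned_coef_def vec_eq_iff)
      have "G k = 0" if "k > nat (R + M)" for k
      proof -
        have "int k \<noteq> R + m i" for i using that M[of i] by linarith
        then show ?thesis by (simp add: G_def vec_eq_iff)
      qed
      then have "H2 G" unfolding H2_def by (intro summable_finite[of "{..nat (R + M)}"]) (auto simp: not_le)
      have "M \<ge> 0" by (simp add: M_def sum_nonneg)
      have zero: "inner (a (int k)) (aligned_coef m G (int k - int n)) = 0"
        "inner (a (int k)) (?J (aligned_coef m G (int k - int n))) = 0" for k n
      proof -
        have "?J 0 = 0" by (simp add: Jvec_def vec_eq_iff J0)
        moreover have "k \<ge> N" if "int k - int n = R" using that \<open>M \<ge> 0\<close> by (simp add: R_def)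
        ultimately show "inner (a (int k)) (aligned_coef m G (int k - int n)) = 0"
          "inner (a (int k)) (?J (aligned_coef m G (int k - int n))) = 0"
          using y by (auto simp: bG)
      qed
      have "(\<Sum>k. inner (F (k + n)) (G k)) = 0 \<and> (\<Sum>k. inner (F (k + n)) (?J (G k))) = 0" for n
        using pair[OF \<open>H2 G\<close>, of n, unfolded zero] has_sum_unique[OF _ has_sum_0_simp] by blast
      then have "G = (\<lambda>k. 0)" by (rule cyc_F[OF \<open>H2 G\<close>])
      then have "aligned_coef m G R = 0" by (simp add: aligned_coef_def coef_def vec_eq_iff)
      then show "y = 0" by (simp add: bG)
    qed
    then show "\<forall>N. closure (cspan ?J {(\<chi> i. coef F i (int k + m i)) | k. k \<ge> N}) = UNIV"
      unfolding spn by blast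
  next
    assume "\<forall>N. closure (cspan ?J {(\<chi> i. coef F i (int k + m i)) | k. k \<ge> N}) = UNIV"
    then have total: "y = 0" if "\<forall>k\<ge>N. inner (a (int k)) y = 0 \<and> inner (a (int k)) (?J y) = 0" for N y
      unfolding spn using that by blast
    define l where "l = enumerate L"
    obtain c where inf: "infinite L" and c: "c > 1" "\<And>k. real (l (Suc k)) \<ge> c * real (l k)"
      using assms(3) by (auto simp: lacunary_def l_def)
    have mono: "strict_mono l" unfolding l_def by (rule strict_mono_enumerate[OF inf])
    have range_l: "range l = L" unfolding l_def by (rule range_enumerate[OF inf])
    have a_off: "a (int k) = 0" if "k \<notin> range l" for k
    proof -
      have "coef F i (int k + m i) = 0" for i
      proof (rule ccontr)
        assume "coef F i (int k + m i) \<noteq> 0"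
        from F_off[OF this] that show False by (auto simp: range_l)
      qed
      then show ?thesis by (simp add: a_def aligned_coef_def vec_eq_iff)
    qed
    \<comment> \<open>Since \<open>a\<close> vanishes off \<open>L\<close>, sums over all indices
      may be taken along the enumeration.\<close>
    have along_l: "((\<lambda>t. \<psi> (l t)) has_sum S) UNIV"
      if "(\<psi> has_sum S) UNIV" "\<And>k. k \<notin> range l \<Longrightarrow> \<psi> k = 0" for \<psi> :: "nat \<Rightarrow> real" and S
    proof -
      have "(\<psi> has_sum S) UNIV \<longleftrightarrow> (\<psi> has_sum S) (range l)"
        by (rule has_sum_cong_neutral) (auto simp: that(2))
      with that(1) show ?thesis
        using has_sum_reindex[OF strict_mono_imp_inj_on[OF mono], of \<psi> UNIV S] by (simp add: o_def)
    qed
    show "cyclic_bshift ?J F"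
      unfolding cyc
    proof (intro allI impI)
      fix G :: "nat \<Rightarrow> 'a^'d"
      assume G: "H2 G" and orth: "\<forall>n. (\<Sum>k. inner (F (k + n)) (G k)) = 0 \<and>
        (\<Sum>k. inner (F (k + n)) (?J (G k))) = 0"
      have b_zero: "aligned_coef m G j = 0" for j
      proof (rule lacunary_correlation_zero[OF J c mono, where \<alpha> = "\<lambda>t. a (int (l t))" and M = M])
        have "(\<lambda>k. (norm (a (int k)))\<^sup>2) summable_on UNIV"
          unfolding a_def
          using summable_on_reindex[of int UNIV "\<lambda>j. (norm (aligned_coef m F j))\<^sup>2"]
            summable_on_subset[OF summable_on_aligned_coef[OF assms(4)], of "range int" m]
          by (simp add: o_def)
        then show "(\<lambda>t. (norm (a (int (l t))))\<^sup>2) summable_on UNIV"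
          using along_l[of "\<lambda>k. (norm (a (int k)))\<^sup>2"] a_off by (auto simp: summable_on_def)
        show "(\<lambda>j. (norm (aligned_coef m G j))\<^sup>2) summable_on UNIV"
          by (rule summable_on_aligned_coef[OF G])
        show "aligned_coef m G i = 0" if "i < - M" for i
        proof -
          have "i + m k < 0" for k using M[of k] that by linarith
          then show ?thesis by (simp add: aligned_coef_def coef_def vec_eq_iff)
        qed
        show "((\<lambda>t. inner (a (int (l t))) (aligned_coef m G (int (l t) - int n))) has_sum 0) UNIV" for n
          using pair(1)[OF G, of n] orth a_off
            along_l[of "\<lambda>k. inner (a (int k)) (aligned_coef m G (int k - int n))" 0] by simp
        show "((\<lambda>t. inner (a (int (l t))) (?J (aligned_coef m G (int (l t) - int n)))) has_sum 0) UNIV" for n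
          using pair(2)[OF G, of n] orth a_off
            along_l[of "\<lambda>k. inner (a (int k)) (?J (aligned_coef m G (int k - int n)))" 0] by simp
        show "completely_rel_compact ?J (\<lambda>t. a (int (l t)))"
          unfolding completely_rel_compact_def
        proof (intro allI impI)
          fix P assume "orth_proj ?J P"
          let ?B = "{P (a (int k)) /\<^sub>R norm (P (a (int k))) | k. P (a (int k)) \<noteq> 0}"
          let ?A = "{P (a (int (l t))) /\<^sub>R norm (P (a (int (l t)))) | t. P (a (int (l t))) \<noteq> 0}"
          have "compact (closure ?B)"
            using assms(6) \<open>orth_proj ?J P\<close> unfolding completely_rel_compact_def a_eq by blast
          \<comment> \<open>The normalised vectors along \<open>l\<close> are among those of the
            full sequence, so their closure is a closed subset of a compact set.\<close>
          then have "compact (closure ?B \<inter> closure ?A)" by (rule compact_Int_closed) simp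
          moreover have "closure ?A \<subseteq> closure ?B" by (rule closure_mono) blast
          ultimately show "compact (closure ?A)" by (simp add: Int_absorb1)
        qed
        fix N y
        assume N: "\<And>s. s \<ge> N \<Longrightarrow> inner (a (int (l s))) y = 0 \<and> inner (a (int (l s))) (?J y) = 0"
        \<comment> \<open>The threshold becomes \<open>l N\<close>: an index
          \<open>k = l s \<ge> l N\<close> has \<open>s \<ge> N\<close>, and off the range of
          \<open>l\<close> the vector is zero.\<close>
        have "inner (a (int k)) y = 0 \<and> inner (a (int k)) (?J y) = 0" if "k \<ge> l N" for k
        proof (cases "k \<in> range l")
          case True
          then obtain s where "k = l s" by blast
          then show ?thesis using that N[of s] mono by (simp add: strict_mono_less_eq)
        qed (simp add: a_off)
        then show "y = 0" using total by blast
      qed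
      \<comment> \<open>Coefficient \<open>k\<close> of coordinate \<open>i\<close> sits at the
        aligned index \<open>k - m i\<close>, which varies with \<open>i\<close>.\<close>
      have "G k $ i = 0" for k i
        using b_zero[of "int k - m i"] by (auto simp: aligned_coef_def vec_eq_iff coef_def dest!: spec[of _ i])
      then show "G = (\<lambda>k. 0)" by (simp add: fun_eq_iff vec_eq_iff)
    qed
  qed
qed

end
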